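(* For every $t,k\in\mathbb{N}$ there exist $C,m_0,N\in\mathbb{N}$ such that if $\mathcal{F}\subset[m]^n$ is $(t-1)$-avoiding with $m\ge m_0$ and $n\ge N\log m$, then there is a $t$-intersecting collection $\mathcal{D}$ of at most $C$ subcubes of co-dimension at most $k$ such that $\mu(\mathcal{F}\setminus\bigcup\mathcal{D})\le Cm^{-k}$.
   Context: $\mu$ is the uniform probability measure on $[m]^n$; ${\sf agr}(x,y)=|\{i:x_i=y_i\}|$; $\mathcal{F}$ is $(t-1)$-avoiding if no $x,y\in\mathcal{F}$ have ${\sf agr}(x,y)=t-1$. A subcube of co-dimension $|R|$ is $D_{R\to\alpha}=\{x\in[m]^n:x_R=\alpha\}$ for $R\subset[n]$, $\alpha\in[m]^R$; $\bigcup\mathcal{D}$ is the union of the subcubes in $\mathcal{D}$. A collection $\mathcal{D}$ of subcubes is $t$-intersecting if for any (not necessarily distinct) $D_{R\to\alpha},D_{R'\to\beta}\in\mathcal{D}$ we have $|\{i\in R\cap R':\alpha_i=\beta_i\}|\ge t$. *)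

theory Defs
  imports Complex_Main "HOL-Library.FuncSet"
begin

definition cube :: "nat \<Rightarrow> nat \<Rightarrow> (nat \<Rightarrow> nat) set" where
  "cube m n = PiE {..<n} (\<lambda>_. {..<m})"

definition mu :: "nat \<Rightarrow> nat \<Rightarrow> (nat \<Rightarrow> nat) set \<Rightarrow> real" where
  "mu m n A = real (card (A \<inter> cube m n)) / real m ^ n"

definition agr :: "nat \<Rightarrow> (nat \<Rightarrow> nat) \<Rightarrow> (nat \<Rightarrow> nat) \<Rightarrow> nat" where
  "agr n x y = card {i \<in> {..<n}. x i = y i}"

definition avoiding :: "nat \<Rightarrow> nat \<Rightarrow> (nat \<Rightarrow> nat) set \<Rightarrow> bool" where
  "avoiding n s F \<longleftrightarrow> (\<forall>x\<in>F. \<forall>y\<in>F. agr n x y \<noteq> s)"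

text \<open>A subcube D_{R->alpha} is represented by the pair (R, alpha),
  with R a subset of {..<n} and alpha in [m]^R; its co-dimension is card R.\<close>
definition is_subcube :: "nat \<Rightarrow> nat \<Rightarrow> (nat set \<times> (nat \<Rightarrow> nat)) \<Rightarrow> bool" where
  "is_subcube m n D \<longleftrightarrow> fst D \<subseteq> {..<n} \<and> snd D \<in> PiE (fst D) (\<lambda>_. {..<m})"

definition subcube :: "nat \<Rightarrow> nat \<Rightarrow> nat set \<Rightarrow> (nat \<Rightarrow> nat) \<Rightarrow> (nat \<Rightarrow> nat) set" where
  "subcube m n R \<alpha> = {x \<in> cube m n. \<forall>i\<in>R. x i = \<alpha> i}"

definition union_cubes :: "nat \<Rightarrow> nat \<Rightarrow> (nat set \<times> (nat \<Rightarrow> nat)) set \<Rightarrow> (nat \<Rightarrow> nat) set" where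
  "union_cubes m n \<D> = (\<Union>(R, \<alpha>)\<in>\<D>. subcube m n R \<alpha>)"

definition t_intersecting_cubes :: "nat \<Rightarrow> (nat set \<times> (nat \<Rightarrow> nat)) set \<Rightarrow> bool" where
  "t_intersecting_cubes t \<D> \<longleftrightarrow>
     (\<forall>(R, \<alpha>)\<in>\<D>. \<forall>(R', \<beta>)\<in>\<D>. card {i \<in> R \<inter> R'. \<alpha> i = \<beta> i} \<ge> t)"

end

theory Submission
  imports Defs
begin

text \<open>
  Branching on the dictators that capture \<open>F\<close>, down to depth \<open>k\<close>, covers \<open>F\<close> up to measure
  \<open>O(m\<^sup>-\<^sup>k)\<close> by boundedly many subcubes in which \<open>F\<close> is not captured by few dictators. Suppose two of
  them agree in fewer than \<open>t\<close> fixed coordinates. Restricting each further, with a maximal number of fixed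
  coordinates subject to the density growing by a factor \<open>K = m\<^sup>\<epsilon>\<close> per coordinate, makes both
  families global; uncapturability lets us do this without creating new agreements. As
  \<open>n\<close> is large compared with \<open>log m\<close>, the remaining agreements can be created by fixing coordinates
  on which both families keep their density. It remains to find a pair that disagrees everywhere else.

  Disagreement everywhere is the noise operator with parameter \<open>\<rho> = -1/(m - 1)\<close>. Writing
  \<open>\<rho> = \<tau> r \<tau>\<close>, the pair exists once \<open>\<parallel>T\<^sub>\<tau> f\<parallel>\<^sub>2\<close> is at most \<open>m\<^sup>\<epsilon>\<close> times the mean of \<open>f\<close>. This
  follows by iterating an \<open>L\<^sub>2 \<rightarrow> L\<^sub>4\<close> hypercontractive inequality for functions all of whose restrictions have
  controlled \<open>L\<^sub>2\<close>-norm, each time interpolating between \<open>L\<^sub>1\<close> and \<open>L\<^sub>4\<close>.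
\<close>

section \<open>Averaging and noise operators\<close>

text \<open>The obstacle is sparsity. The families may have density as small as
  \<open>m^(-k)\<close>, so their normalised second moments can be of order \<open>m^k\<close>,
  while the parameter \<open>-1/(m - 1)\<close> gains only one factor \<open>m\<close>: a plain
  spectral bound fails for larger \<open>k\<close>. Smoothing has to reduce that ratio first. One
  smoothing by 1/3 lowers its bound to the power 2/3, so a number of steps depending on
  \<open>k\<close> alone brings it to about \<open>m^(1/4)\<close>, at the price of a constant
  factor 9 per step. Globalness makes these steps possible; it costs a factor \<open>K\<close> per
  smoothed function, and \<open>K^t\<close> more once up to \<open>t\<close> coordinates are fixed
  to create agreements. With \<open>K = m^(1/(8(t + 1)))\<close> the total loss is
  \<open>sqrt m\<close> up to constants, against the available \<open>m - 1\<close>. Conversely,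
  \<open>K\<close> must be a fixed power of \<open>m\<close>: a density of \<open>m^(-k)\<close> can
  grow by a factor \<open>K\<close> only boundedly often, so the number of coordinates fixed for
  globalness, and hence the number of dictators that uncapturability has to withstand, depends
  neither on \<open>m\<close> nor on \<open>n\<close>.\<close>

definition indep :: "nat \<Rightarrow> ((nat \<Rightarrow> nat) \<Rightarrow> real) \<Rightarrow> bool" where
  "indep i f \<longleftrightarrow> (\<forall>x a. f (x(i := a)) = f x)"

text \<open>Functions have all of \<open>nat \<Rightarrow> nat\<close> as their domain, so averages
  are evaluated at base points that may differ in irrelevant coordinates. This predicate (a junta on
  \<open>N\<close>) is what permits exchanging such base points.\<close>

definition dep :: "nat set \<Rightarrow> ((nat \<Rightarrow> nat) \<Rightarrow> real) \<Rightarrow> bool" where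
  "dep N f \<longleftrightarrow> (\<forall>x y. (\<forall>i\<in>N. x i = y i) \<longrightarrow> f x = f y)"

locale alphabet =
  fixes m :: nat
  assumes m_pos: "0 < m"
begin

definition avg :: "nat \<Rightarrow> ((nat \<Rightarrow> nat) \<Rightarrow> real) \<Rightarrow> (nat \<Rightarrow> nat) \<Rightarrow> real" where
  "avg i f x = (\<Sum>a<m. f (x(i := a))) / real m"

definition noise1 :: "real \<Rightarrow> nat \<Rightarrow> ((nat \<Rightarrow> nat) \<Rightarrow> real) \<Rightarrow> (nat \<Rightarrow> nat) \<Rightarrow> real" where
  "noise1 \<rho> i f x = \<rho> * f x + (1 - \<rho>) * avg i f x"

definition noise :: "real \<Rightarrow> nat set \<Rightarrow> ((nat \<Rightarrow> nat) \<Rightarrow> real) \<Rightarrow> (nat \<Rightarrow> nat) \<Rightarrow> real" where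
  "noise \<rho> S f = Finite_Set.fold (noise1 \<rho>) f S"

text \<open>\<open>Av (N - S) f x\<close> is the mean of the restriction of \<open>f\<close> in which the coordinates in \<open>S\<close> are fixed
  to those of \<open>x\<close>; restrictions are never introduced as functions on smaller cubes.\<close>
abbreviation Av :: "nat set \<Rightarrow> ((nat \<Rightarrow> nat) \<Rightarrow> real) \<Rightarrow> (nat \<Rightarrow> nat) \<Rightarrow> real" where
  "Av \<equiv> noise 0"

lemma avg_lin: "avg i (\<lambda>x. u * f x + v * g x) x = u * avg i f x + v * avg i g x"
  by (simp add: avg_def sum.distrib sum_distrib_left add_divide_distrib)

lemma avg_const [simp]: "avg i (\<lambda>x. c) x = c"
  using m_pos by (simp add: avg_def)

lemma avg_mono: "(\<And>x. f x \<le> g x) \<Longrightarrow> avg i f x \<le> avg i g x"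
  by (auto simp: avg_def intro!: divide_right_mono sum_mono)

lemma avg_comm: "avg i (avg j f) x = avg j (avg i f) x"
proof (cases "i = j")
  case False
  have "(\<Sum>a<m. \<Sum>b<m. f (x(i := a, j := b))) = (\<Sum>b<m. \<Sum>a<m. f (x(j := b, i := a)))"
    by (subst sum.swap) (use False in \<open>simp add: fun_upd_twist\<close>)
  then show ?thesis
    by (simp add: avg_def flip: sum_divide_distrib)
qed simp

lemma indep_avg: "indep i (avg i f)"
  by (simp add: indep_def avg_def)

lemma indep_avg_other: "indep j f \<Longrightarrow> indep j (avg i f)"
  by (cases "i = j") (simp_all add: indep_def avg_def fun_upd_twist)

lemma avg_indep: "indep i f \<Longrightarrow> avg i f x = f x"
  using m_pos by (simp add: indep_def avg_def)

lemma avg_indep_mult: "indep i f \<Longrightarrow> avg i (\<lambda>x. f x * g x) x = f x * avg i g x"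
  by (simp add: indep_def avg_def sum_distrib_left)

lemma avg_avg [simp]: "avg i (avg i f) x = avg i f x"
  by (rule avg_indep[OF indep_avg])

lemma noise1_lin:
  "noise1 \<rho> i (\<lambda>x. u * f x + v * g x) x = u * noise1 \<rho> i f x + v * noise1 \<rho> i g x"
  by (simp add: noise1_def avg_lin algebra_simps)

lemma avg_noise1: "avg i (noise1 \<rho> j f) x = \<rho> * avg i f x + (1 - \<rho>) * avg i (avg j f) x"
  unfolding noise1_def by (rule avg_lin)

lemma noise1_comm: "noise1 \<rho> i (noise1 \<sigma> j f) = noise1 \<sigma> j (noise1 \<rho> i f)"
proof
  fix x
  show "noise1 \<rho> i (noise1 \<sigma> j f) x = noise1 \<sigma> j (noise1 \<rho> i f) x"
    unfolding noise1_def[of \<rho> i "noise1 \<sigma> j f"] noise1_def[of \<sigma> j "noise1 \<rho> i f"] avg_noise1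
    by (simp add: noise1_def avg_comm[of i j] algebra_simps)
qed

lemma noise1_const [simp]: "noise1 \<rho> i (\<lambda>x. c) = (\<lambda>x. c)"
  by (rule ext) (simp add: noise1_def algebra_simps)

lemma noise1_mono:
  assumes "0 \<le> \<rho>" "\<rho> \<le> 1" "\<And>x. f x \<le> g x"
  shows "noise1 \<rho> i f x \<le> noise1 \<rho> i g x"
  unfolding noise1_def using assms avg_mono[of f g i x]
  by (intro add_mono mult_left_mono) auto

lemma noise1_0: "noise1 0 i = avg i"
  by (intro ext) (simp add: noise1_def)

section \<open>Noise on a set of coordinates\<close>

lemma noise_empty [simp]: "noise \<rho> {} f = f"
  by (simp add: noise_def)

lemma noise_insert:
  assumes "finite S" "i \<notin> S"
  shows "noise \<rho> (insert i S) f = noise1 \<rho> i (noise \<rho> S f)"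
proof -
  interpret comp_fun_commute "noise1 \<rho>"
    by standard (auto simp: noise1_comm)
  show ?thesis using assms by (simp add: noise_def)
qed

lemma noise_noise1_comm: "finite S \<Longrightarrow> noise \<rho> S (noise1 \<sigma> i f) = noise1 \<sigma> i (noise \<rho> S f)"
  by (induction S rule: finite_induct) (auto simp: noise_insert noise1_comm)

lemma noise_insert':
  "finite S \<Longrightarrow> i \<notin> S \<Longrightarrow> noise \<rho> (insert i S) f = noise \<rho> S (noise1 \<rho> i f)"
  by (simp add: noise_insert noise_noise1_comm)

lemma noise_comm:
  "finite S \<Longrightarrow> finite U \<Longrightarrow> noise \<rho> S (noise \<sigma> U f) = noise \<sigma> U (noise \<rho> S f)"
  by (induction S rule: finite_induct) (auto simp: noise_insert noise_noise1_comm)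

lemma noise_avg_comm: "finite S \<Longrightarrow> noise \<rho> S (avg i f) = avg i (noise \<rho> S f)"
  using noise_noise1_comm[of S \<rho> 0 i f] by (simp add: noise1_0)

lemma noise_Un:
  "finite S \<Longrightarrow> finite U \<Longrightarrow> S \<inter> U = {} \<Longrightarrow> noise \<rho> (S \<union> U) f = noise \<rho> S (noise \<rho> U f)"
  by (induction S rule: finite_induct) (auto simp: noise_insert)

lemma Av_insert: "finite S \<Longrightarrow> i \<notin> S \<Longrightarrow> Av (insert i S) f = avg i (Av S f)"
  by (simp add: noise_insert noise1_0)

lemma Av_insert': "finite S \<Longrightarrow> i \<notin> S \<Longrightarrow> Av (insert i S) f = Av S (avg i f)"
  by (simp add: noise_insert' noise1_0)

lemma noise_lin:
  "finite S \<Longrightarrow> noise \<rho> S (\<lambda>x. u * f x + v * g x) = (\<lambda>x. u * noise \<rho> S f x + v * noise \<rho> S g x)"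
proof (induction S rule: finite_induct)
  case (insert i S)
  then show ?case by (simp add: noise_insert noise1_lin[abs_def])
qed simp

lemma noise_add: "finite S \<Longrightarrow> noise \<rho> S (\<lambda>x. f x + g x) = (\<lambda>x. noise \<rho> S f x + noise \<rho> S g x)"
  using noise_lin[of S \<rho> 1 f 1 g] by simp

lemma noise_diff: "finite S \<Longrightarrow> noise \<rho> S (\<lambda>x. f x - g x) = (\<lambda>x. noise \<rho> S f x - noise \<rho> S g x)"
  using noise_lin[of S \<rho> 1 f "-1" g] by simp

lemma noise_cmult: "finite S \<Longrightarrow> noise \<rho> S (\<lambda>x. u * f x) = (\<lambda>x. u * noise \<rho> S f x)"
  using noise_lin[of S \<rho> u f 0 f] by simp

lemma noise_const [simp]: "finite S \<Longrightarrow> noise \<rho> S (\<lambda>x. c) = (\<lambda>x. c)"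
  by (induction S rule: finite_induct) (auto simp: noise_insert)

lemma noise_sum:
  "finite J \<Longrightarrow> finite S \<Longrightarrow> noise \<rho> S (\<lambda>x. \<Sum>j\<in>J. f j x) = (\<lambda>x. \<Sum>j\<in>J. noise \<rho> S (f j) x)"
  by (induction J rule: finite_induct) (simp_all add: noise_add)

lemma noise_mono:
  assumes "finite S" "0 \<le> \<rho>" "\<rho> \<le> 1" "\<And>x. f x \<le> g x"
  shows "noise \<rho> S f x \<le> noise \<rho> S g x"
  using assms(1)
proof (induction S arbitrary: x rule: finite_induct)
  case (insert i S)
  then show ?case using assms by (simp add: noise_insert noise1_mono)
qed (simp add: assms)

lemma noise_le_const:
  "finite S \<Longrightarrow> 0 \<le> \<rho> \<Longrightarrow> \<rho> \<le> 1 \<Longrightarrow> (\<And>x. f x \<le> c) \<Longrightarrow> noise \<rho> S f x \<le> c"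
  using noise_mono[of S \<rho> f "\<lambda>x. c" x] by simp

lemma noise_ge_const:
  "finite S \<Longrightarrow> 0 \<le> \<rho> \<Longrightarrow> \<rho> \<le> 1 \<Longrightarrow> (\<And>x. c \<le> f x) \<Longrightarrow> c \<le> noise \<rho> S f x"
  using noise_mono[of S \<rho> "\<lambda>x. c" f x] by simp

lemma indep_noise: "finite S \<Longrightarrow> indep j f \<Longrightarrow> indep j (noise \<rho> S f)"
proof (induction S rule: finite_induct)
  case (insert i S)
  then have *: "indep j (noise \<rho> S f)" by simp
  with indep_avg_other[OF *, of i] insert show ?case
    by (simp add: noise_insert indep_def noise1_def)
qed simp

lemma noise_Jensen:
  assumes "finite S" "0 \<le> \<rho>" "\<rho> \<le> 1"
  shows "(noise \<rho> S f x)\<^sup>2 \<le> noise \<rho> S (\<lambda>y. (f y)\<^sup>2) x"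
proof -
  define c where "c = noise \<rho> S f x"
  have "0 \<le> noise \<rho> S (\<lambda>y. (f y - c)\<^sup>2) x"
    using assms by (intro noise_ge_const) auto
  also have "(\<lambda>y. (f y - c)\<^sup>2) = (\<lambda>y. 1 * (f y)\<^sup>2 + 1 * ((- (2 * c)) * f y + c\<^sup>2 * 1))"
    by (auto simp: power2_eq_square algebra_simps)
  also have "noise \<rho> S \<dots> x = noise \<rho> S (\<lambda>y. (f y)\<^sup>2) x - 2 * c * c + c\<^sup>2"
    using assms by (simp only: noise_lin noise_const) (simp add: c_def)
  finally show ?thesis by (simp add: c_def power2_eq_square)
qed

lemma Av_Cauchy_Schwarz:
  assumes "finite S"
  shows "(Av S (\<lambda>y. f y * g y) x)\<^sup>2 \<le> Av S (\<lambda>y. (f y)\<^sup>2) x * Av S (\<lambda>y. (g y)\<^sup>2) x"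
proof -
  define A B C where "A = Av S (\<lambda>y. (f y)\<^sup>2) x" and "B = Av S (\<lambda>y. f y * g y) x"
    and "C = Av S (\<lambda>y. (g y)\<^sup>2) x"
  have quad: "0 \<le> a\<^sup>2 * A + 2 * a * b * B + b\<^sup>2 * C" for a b
  proof -
    have "0 \<le> Av S (\<lambda>y. (a * f y + b * g y)\<^sup>2) x"
      using assms by (intro noise_ge_const) auto
    also have "(\<lambda>y. (a * f y + b * g y)\<^sup>2)
        = (\<lambda>y. a\<^sup>2 * (f y)\<^sup>2 + 1 * ((2 * a * b) * (f y * g y) + b\<^sup>2 * (g y)\<^sup>2))"
      by (auto simp: power2_eq_square algebra_simps)
    also have "Av S \<dots> x = a\<^sup>2 * A + 2 * a * b * B + b\<^sup>2 * C"
      using assms by (simp only: noise_lin) (simp add: A_def B_def C_def)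
    finally show ?thesis .
  qed
  have "0 \<le> C" unfolding C_def using assms by (intro noise_ge_const) auto
  show ?thesis
  proof (cases "C = 0")
    case True
    have "B = 0"
    proof (rule ccontr)
      assume "B \<noteq> 0"
      \<comment> \<open>For \<open>C = 0\<close> the form is affine in \<open>b\<close>, and this
        choice of \<open>b\<close> gives the value -1.\<close>
      with quad[of 1 "- (A + 1) / (2 * B)"] True show False by (simp add: field_simps)
    qed
    then show ?thesis using True by (simp add: A_def B_def C_def)
  next
    case False
    with \<open>0 \<le> C\<close> have "C > 0" by simp
    have "0 \<le> C\<^sup>2 * A + 2 * C * (- B) * B + (- B)\<^sup>2 * C" by (rule quad)
    also have "\<dots> = C * (A * C - B\<^sup>2)" by (simp add: power2_eq_square algebra_simps)
    finally have "B\<^sup>2 \<le> A * C" using \<open>C > 0\<close> by (simp add: zero_le_mult_iff)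
    then show ?thesis by (simp add: A_def B_def C_def)
  qed
qed

text \<open>The operator fixes the part independent of \<open>i\<close> and scales the part centered
  in \<open>i\<close> by its parameter, so parameters multiply, whatever their sign. This is what
  allows a negative parameter to be factored.\<close>

lemma noise1_noise1: "noise1 \<rho> i (noise1 \<sigma> i f) = noise1 (\<rho> * \<sigma>) i f"
  unfolding noise1_def[of \<rho> i "noise1 \<sigma> i f"] avg_noise1
  by (rule ext) (simp add: noise1_def algebra_simps)

lemma noise_noise: "finite S \<Longrightarrow> noise \<rho> S (noise \<sigma> S f) = noise (\<rho> * \<sigma>) S f"
proof (induction S arbitrary: f rule: finite_induct)
  case (insert i S)
  then show ?case by (simp add: noise_insert noise_noise1_comm noise1_noise1 mult.commute)
qed simp

text \<open>Smoothing preserves means: a full average absorbs it, by the semigroup law with one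
  parameter equal to 0.\<close>

lemma Av_subset_noise:
  assumes "finite S" "U \<subseteq> S"
  shows "Av S (noise \<rho> U f) = Av S f"
proof -
  have U: "finite U" using assms finite_subset by blast
  have S: "S = (S - U) \<union> U" using assms by blast
  have "Av ((S - U) \<union> U) g = Av (S - U) (Av U g)" for g
    using assms U by (intro noise_Un) auto
  then have *: "Av S g = Av (S - U) (Av U g)" for g using S by simp
  show ?thesis using U by (simp add: * noise_noise)
qed

lemma avg_selfadjoint: "avg i (\<lambda>x. f x * avg i g x) x = avg i (\<lambda>x. avg i f x * g x) x"
proof -
  have "avg i (\<lambda>x. f x * avg i g x) x = avg i g x * avg i f x"
    using avg_indep_mult[OF indep_avg, of i g f x] by (simp add: mult.commute)
  also have "\<dots> = avg i (\<lambda>x. avg i f x * g x) x"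
    using avg_indep_mult[OF indep_avg, of i f g x] by simp
  finally show ?thesis .
qed

lemma noise1_selfadjoint:
  "avg i (\<lambda>x. f x * noise1 \<rho> i g x) x = avg i (\<lambda>x. noise1 \<rho> i f x * g x) x"
proof -
  have "avg i (\<lambda>x. f x * noise1 \<rho> i g x) x
      = avg i (\<lambda>x. \<rho> * (f x * g x) + (1 - \<rho>) * (f x * avg i g x)) x"
    by (simp add: noise1_def algebra_simps)
  also have "\<dots> = avg i (\<lambda>x. \<rho> * (f x * g x) + (1 - \<rho>) * (avg i f x * g x)) x"
    by (simp only: avg_lin avg_selfadjoint)
  also have "\<dots> = avg i (\<lambda>x. noise1 \<rho> i f x * g x) x"
    by (simp add: noise1_def algebra_simps)
  finally show ?thesis .
qed

lemma noise_selfadjoint: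
  assumes "finite N" "S \<subseteq> N"
  shows "Av N (\<lambda>x. f x * noise \<rho> S g x) = Av N (\<lambda>x. noise \<rho> S f x * g x)"
proof -
  have "finite S" using assms finite_subset by blast
  then show ?thesis using assms(2)
  proof (induction S arbitrary: f g rule: finite_induct)
    case (insert i S)
    have N: "Av N h = Av (N - {i}) (avg i h)" for h
      using Av_insert'[of "N - {i}" i h] assms insert by (simp add: insert_absorb)
    have "Av N (\<lambda>x. f x * noise \<rho> (insert i S) g x) = Av N (\<lambda>x. f x * noise \<rho> S (noise1 \<rho> i g) x)"
      using insert by (simp add: noise_insert')
    also have "\<dots> = Av N (\<lambda>x. noise \<rho> S f x * noise1 \<rho> i g x)"
      using insert by simp
    also have "\<dots> = Av N (\<lambda>x. noise1 \<rho> i (noise \<rho> S f) x * g x)"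
      by (simp only: N noise1_selfadjoint[abs_def])
    finally show ?case using insert by (simp add: noise_insert)
  qed simp
qed

section \<open>Dependence on coordinates, and points found by averaging\<close>

lemma dep_Av:
  assumes "finite S" "dep N f"
  shows "dep (N - S) (Av S f)"
  using assms(1)
proof (induction S rule: finite_induct)
  case empty
  then show ?case using assms(2) by simp
next
  case (insert i S)
  have "avg i (Av S f) x = avg i (Av S f) y" if "\<forall>j\<in>N - insert i S. x j = y j" for x y
  proof -
    have "Av S f (x(i := a)) = Av S f (y(i := a))" for a
      by (rule insert.IH[unfolded dep_def, rule_format]) (use that in auto)
    then show ?thesis by (simp add: avg_def)
  qed
  then show ?case using insert by (simp add: Av_insert dep_def)
qed

lemma Av_cong_dep:
  "finite S \<Longrightarrow> dep N f \<Longrightarrow> (\<And>i. i \<in> N \<Longrightarrow> i \<notin> S \<Longrightarrow> x i = y i) \<Longrightarrow> Av S f x = Av S f y"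
  using dep_Av[of S N f] by (auto simp: dep_def)

lemma Av_override:
  assumes "finite S" "S \<inter> R = {}"
  shows "Av S (\<lambda>x. f (override_on x \<alpha> R)) x = Av S f (override_on x \<alpha> R)"
  using assms
proof (induction S arbitrary: x rule: finite_induct)
  case (insert i S)
  have "override_on (x(i := a)) \<alpha> R = (override_on x \<alpha> R)(i := a)" for a
    using insert.prems by (auto simp: override_on_def fun_eq_iff)
  then show ?case using insert by (simp add: Av_insert avg_def)
qed simp

lemma Av_pos_witness:
  assumes "finite S" "0 < Av S f x"
  shows "\<exists>y. (\<forall>i\<in>S. y i < m) \<and> (\<forall>i. i \<notin> S \<longrightarrow> y i = x i) \<and> 0 < f y"
  using assms
proof (induction S arbitrary: x rule: finite_induct)
  case empty
  then show ?case by auto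
next
  case (insert i S)
  have "0 < (\<Sum>a<m. Av S f (x(i := a)))"
    using insert.prems insert.hyps by (simp add: Av_insert avg_def zero_less_divide_iff)
  then obtain a where a: "a < m" "0 < Av S f (x(i := a))"
    by (metis lessThan_iff not_less sum_nonpos)
  obtain y where y: "\<forall>j\<in>S. y j < m" "\<forall>j. j \<notin> S \<longrightarrow> y j = (x(i := a)) j" "0 < f y"
    using insert.IH[OF a(2)] by blast
  have "y i = a" using y(2) insert.hyps by simp
  then show ?case using y a(1) by (intro exI[of _ y]) auto
qed

section \<open>Hypercontractivity for global functions\<close>

lemma Av_indep_mult:
  assumes "finite M" "\<And>i. i \<in> M \<Longrightarrow> indep i g"
  shows "Av M (\<lambda>x. g x * f x) = (\<lambda>x. g x * Av M f x)"
  using assms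
proof (induction M rule: finite_induct)
  case (insert i M)
  then have "avg i (\<lambda>x. g x * Av M f x) x = g x * avg i (Av M f) x" for x
    by (intro avg_indep_mult) auto
  with insert show ?case by (intro ext) (simp add: Av_insert)
qed simp

lemma avg_Jensen: "(avg i f x)\<^sup>2 \<le> avg i (\<lambda>y. (f y)\<^sup>2) x"
  using noise_Jensen[of "{i}" 0 f x] by (simp add: Av_insert)

lemma avg_centered: "avg i (\<lambda>x. f x - avg i f x) x = 0"
  using avg_lin[of i 1 f "-1" "avg i f" x] by simp

lemma avg_square_decomp:
  "avg i (\<lambda>x. (g x)\<^sup>2) x = (avg i g x)\<^sup>2 + avg i (\<lambda>x. (g x - avg i g x)\<^sup>2) x"
proof -
  have "avg i (\<lambda>x. (g x)\<^sup>2) x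
      = avg i (\<lambda>x. 1 * (1 * (avg i g x * avg i g x) + 1 * ((g x - avg i g x)\<^sup>2))
           + 2 * (avg i g x * (g x - avg i g x))) x"
    by (rule arg_cong[of _ _ "\<lambda>h. avg i h x"]) (simp add: fun_eq_iff power2_eq_square algebra_simps)
  also have "\<dots> = (avg i g x)\<^sup>2 + avg i (\<lambda>x. (g x - avg i g x)\<^sup>2) x"
    unfolding avg_lin avg_indep_mult[OF indep_avg] avg_centered
    by (simp add: power2_eq_square)
  finally show ?thesis .
qed

text \<open>In the application \<open>a\<close>, \<open>c\<close> are free of a coordinate and
  \<open>b\<close>, \<open>d\<close> are centered in it. The last two terms are then linear in a
  centered part and vanish on averaging, so their coefficients can be chosen to make the difference
  of the sides a sum of squares. The first function meets \<open>c\<close> as \<open>a + b\<close>,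
  that is, without smoothing. The coefficients 4/9 and 1/27 fit the induction below, where the bound
  for \<open>b\<close> is ten times that for \<open>a\<close>: 4/9 + 10/27 = 22/27 is less than
  1.\<close>

lemma two_point_ineq:
  fixes a b c d :: real
  shows "(a + b / 3)\<^sup>2 * (c + d / 3)\<^sup>2
    \<le> (a + b)\<^sup>2 * c\<^sup>2 + (4/9 * a\<^sup>2 + 1/27 * b\<^sup>2) * d\<^sup>2 + (-4/3) * ((a * c\<^sup>2) * b) + 2/3 * ((a\<^sup>2 * c) * d)"
proof -
  have "(a + b)\<^sup>2 * c\<^sup>2 + (4/9 * a\<^sup>2 + 1/27 * b\<^sup>2) * d\<^sup>2 + (-4/3) * ((a * c\<^sup>2) * b)
      + 2/3 * ((a\<^sup>2 * c) * d) - (a + b / 3)\<^sup>2 * (c + d / 3)\<^sup>2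
    = 2/9 * (a * d - b * c)\<^sup>2 + 1/81 * (3 * a * d - b * d)\<^sup>2 + 1/81 * (3 * b * c - b * d)\<^sup>2
      + 5/9 * (b * c)\<^sup>2"
    by (simp add: power2_eq_square field_simps)
  also have "\<dots> \<ge> 0" by simp
  finally show ?thesis by simp
qed

lemma avg_two_point:
  assumes "indep i a" "indep i c" "\<And>x. avg i b x = 0" "\<And>x. avg i d x = 0"
  shows "avg i (\<lambda>x. (a x + b x / 3)\<^sup>2 * (c x + d x / 3)\<^sup>2) x
    \<le> avg i (\<lambda>x. (a x + b x)\<^sup>2 * (c x)\<^sup>2) x + avg i (\<lambda>x. (4/9 * (a x)\<^sup>2 + 1/27 * (b x)\<^sup>2) * (d x)\<^sup>2) x"
proof -
  have "avg i (\<lambda>x. (a x + b x / 3)\<^sup>2 * (c x + d x / 3)\<^sup>2) x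
    \<le> avg i (\<lambda>x. 1 * (1 * ((a x + b x)\<^sup>2 * (c x)\<^sup>2) + 1 * ((4/9 * (a x)\<^sup>2 + 1/27 * (b x)\<^sup>2) * (d x)\<^sup>2))
       + 1 * ((-4/3) * ((a x * (c x)\<^sup>2) * b x) + 2/3 * (((a x)\<^sup>2 * c x) * d x))) x"
  proof (rule avg_mono)
    fix y
    show "(a y + b y / 3)\<^sup>2 * (c y + d y / 3)\<^sup>2
      \<le> 1 * (1 * ((a y + b y)\<^sup>2 * (c y)\<^sup>2) + 1 * ((4/9 * (a y)\<^sup>2 + 1/27 * (b y)\<^sup>2) * (d y)\<^sup>2))
       + 1 * ((-4/3) * ((a y * (c y)\<^sup>2) * b y) + 2/3 * (((a y)\<^sup>2 * c y) * d y))"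
      using two_point_ineq[of "a y" "b y" "c y" "d y"] by (simp only: mult_1 add.assoc)
  qed
  also have "\<dots> = avg i (\<lambda>x. (a x + b x)\<^sup>2 * (c x)\<^sup>2) x
      + avg i (\<lambda>x. (4/9 * (a x)\<^sup>2 + 1/27 * (b x)\<^sup>2) * (d x)\<^sup>2) x
      + ((-4/3) * avg i (\<lambda>x. (a x * (c x)\<^sup>2) * b x) x + 2/3 * avg i (\<lambda>x. ((a x)\<^sup>2 * c x) * d x) x)"
    unfolding avg_lin by simp
  also have "avg i (\<lambda>x. (a x * (c x)\<^sup>2) * b x) x = 0"
    using assms by (subst avg_indep_mult) (auto simp: indep_def)
  also have "avg i (\<lambda>x. ((a x)\<^sup>2 * c x) * d x) x = 0"
    using assms by (subst avg_indep_mult) (auto simp: indep_def)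
  finally show ?thesis by simp
qed

lemma noise_insert_decomp:
  assumes "finite N" "i \<notin> N"
  shows "noise \<rho> (insert i N) f
    = (\<lambda>x. noise \<rho> N (avg i f) x + \<rho> * noise \<rho> N (\<lambda>x. f x - avg i f x) x)"
proof -
  have "noise1 \<rho> i f = (\<lambda>x. 1 * avg i f x + \<rho> * (f x - avg i f x))"
    by (simp add: noise1_def fun_eq_iff algebra_simps)
  then have "noise \<rho> (insert i N) f = noise \<rho> N (\<lambda>x. 1 * avg i f x + \<rho> * (f x - avg i f x))"
    using noise_insert'[OF assms, of \<rho> f] by (simp only:)
  also have "\<dots> = (\<lambda>x. 1 * noise \<rho> N (avg i f) x + \<rho> * noise \<rho> N (\<lambda>x. f x - avg i f x) x)"
    by (rule noise_lin[OF assms(1)])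
  finally show ?thesis by simp
qed

lemma avg_noise_centered:
  assumes "finite N"
  shows "avg i (noise \<rho> N (\<lambda>x. f x - avg i f x)) x = 0"
proof -
  have "avg i (noise \<rho> N (\<lambda>x. f x - avg i f x)) = noise \<rho> N (avg i (\<lambda>x. f x - avg i f x))"
    using assms by (simp add: noise_avg_comm)
  also have "avg i (\<lambda>x. f x - avg i f x) = (\<lambda>x. 0)"
    by (simp add: avg_centered fun_eq_iff)
  finally show ?thesis using assms by simp
qed

text \<open>The two functions are kept separate, and \<open>M\<close> is introduced, to make the induction on \<open>N\<close> work: the
  part of the second function not depending on the new coordinate \<open>i\<close> leaves the first one unsmoothed in \<open>i\<close>,
  so there \<open>i\<close> moves from \<open>N\<close> to \<open>M\<close>.\<close>
lemma hypercontractive: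
  assumes "finite N" "finite M" "N \<inter> M = {}"
    and "\<And>S x. S \<subseteq> N \<Longrightarrow> Av (N - S) (Av M (\<lambda>x. (f x)\<^sup>2)) x \<le> 4 ^ card S * \<Gamma>"
    and "\<And>i. i \<in> M \<Longrightarrow> indep i g"
  shows "Av N (Av M (\<lambda>x. (noise (1/3) N f x)\<^sup>2 * (noise (1/3) N g x)\<^sup>2)) x
    \<le> \<Gamma> * Av N (\<lambda>x. (g x)\<^sup>2) x"
  using assms
proof (induction N arbitrary: M f g \<Gamma> x rule: finite_induct)
  case empty
  have "Av M (\<lambda>x. (f x)\<^sup>2) x \<le> \<Gamma>" using empty(3)[of "{}" x] by simp
  moreover have "Av M (\<lambda>x. (g x)\<^sup>2 * (f x)\<^sup>2) x = (g x)\<^sup>2 * Av M (\<lambda>x. (f x)\<^sup>2) x"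
    by (subst Av_indep_mult) (use empty in \<open>auto simp: indep_def\<close>)
  ultimately show ?case 
    using mult_left_mono[of "Av M (\<lambda>x. (f x)\<^sup>2) x" \<Gamma> "(g x)\<^sup>2"] by (simp add: mult.commute)
next
  case (insert i N)
  let ?T = "noise (1/3) N"
  define a where "a = avg i f"
  define b where "b = (\<lambda>x. f x - avg i f x)"
  define c where "c = avg i g"
  define d where "d = (\<lambda>x. g x - avg i g x)"
  have fin: "finite N" "finite M" and i: "i \<notin> N" "i \<notin> M" and NM: "N \<inter> M = {}"
    using insert by auto
  have Tf: "noise (1/3) (insert i N) f = (\<lambda>x. ?T a x + ?T b x / 3)"
    and Tg: "noise (1/3) (insert i N) g = (\<lambda>x. ?T c x + ?T d x / 3)"
    using noise_insert_decomp[OF fin(1) i(1)] by (simp_all add: a_def b_def c_def d_def)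
  have Tfab: "?T f = (\<lambda>x. ?T a x + ?T b x)"
    using noise_add[OF fin(1), of "1/3" a b] by (simp add: a_def b_def)
  have hyp: "Av (N - S) (Av M (avg i (\<lambda>x. (f x)\<^sup>2))) y \<le> 4 ^ card S * \<Gamma>" if "S \<subseteq> N" for S y
  proof -
    have "insert i N - S = insert i (N - S)" using that i by auto
    then have "Av (insert i (N - S)) (Av M (\<lambda>x. (f x)\<^sup>2)) y \<le> 4 ^ card S * \<Gamma>"
      using insert.prems(3)[of S y] that by auto
    then show ?thesis using fin i by (simp add: Av_insert' noise_avg_comm)
  qed
  \<comment> \<open>Fixing \<open>i\<close> as well uses up one of the factors 4 that the hypothesis
    allows per fixed coordinate.\<close>
  have hyp': "Av (N - S) (Av M (\<lambda>x. (f x)\<^sup>2)) y \<le> 4 * (4 ^ card S * \<Gamma>)" if "S \<subseteq> N" for S y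
  proof -
    have "insert i N - insert i S = N - S" using i by auto
    moreover have "card (insert i S) = Suc (card S)"
      using that i fin by (subst card_insert_disjoint) (auto dest: finite_subset)
    moreover have "insert i S \<subseteq> insert i N" using that by auto
    ultimately show ?thesis using insert.prems(3)[of "insert i S" y] by (simp add: mult.assoc)
  qed
  have "0 \<le> Av (insert i N) (Av M (\<lambda>x. (f x)\<^sup>2)) x"
    using fin by (intro noise_ge_const) auto
  also have "\<dots> \<le> \<Gamma>" using insert.prems(3)[of "{}" x] by simp
  finally have \<Gamma>: "0 \<le> \<Gamma>" .
  have hypa: "Av (N - S) (Av M (\<lambda>x. (a x)\<^sup>2)) y \<le> 4 ^ card S * \<Gamma>" if "S \<subseteq> N" for S y
  proof -
    have "Av (N - S) (Av M (\<lambda>x. (a x)\<^sup>2)) y \<le> Av (N - S) (Av M (avg i (\<lambda>x. (f x)\<^sup>2))) y"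
      using fin avg_Jensen unfolding a_def by (intro noise_mono) auto
    with hyp[OF that, of y] show ?thesis by simp
  qed
  \<comment> \<open>The 10 is 2 * 4 + 2 * 1: in \<open>f^2\<close> the coordinate \<open>i\<close>
    stays fixed, in \<open>a^2\<close> it is averaged.\<close>
  have hypb: "Av (N - S) (Av M (\<lambda>x. (b x)\<^sup>2)) y \<le> 4 ^ card S * (10 * \<Gamma>)" if "S \<subseteq> N" for S y
  proof -
    have "(b x)\<^sup>2 \<le> 2 * (f x)\<^sup>2 + 2 * (a x)\<^sup>2" for x
      using zero_le_power2[of "f x + a x"]
      by (simp add: b_def a_def power2_eq_square algebra_simps)
    then have "Av (N - S) (Av M (\<lambda>x. (b x)\<^sup>2)) y
        \<le> Av (N - S) (Av M (\<lambda>x. 2 * (f x)\<^sup>2 + 2 * (a x)\<^sup>2)) y"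
      using fin by (intro noise_mono) auto
    also have "\<dots> = 2 * Av (N - S) (Av M (\<lambda>x. (f x)\<^sup>2)) y + 2 * Av (N - S) (Av M (\<lambda>x. (a x)\<^sup>2)) y"
      using fin by (simp add: noise_lin)
    also have "\<dots> \<le> 4 ^ card S * (10 * \<Gamma>)"
      using hyp'[OF that, of y] hypa[OF that, of y] by simp
    finally show ?thesis .
  qed
  have indc: "indep j c" and indd: "indep j d" if "j \<in> M" for j
    using insert.prems(4)[OF that] indep_avg_other[of j g i]
    by (auto simp: c_def d_def indep_def)
  have indci: "indep j c" if "j \<in> insert i M" for j
    using indc indep_avg[of i g] that by (auto simp: c_def)
  have step1: "Av N (Av M (avg i (\<lambda>x. (?T f x)\<^sup>2 * (?T c x)\<^sup>2))) x \<le> \<Gamma> * Av N (\<lambda>x. (c x)\<^sup>2) x"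
  proof -
    have "Av N (Av (insert i M) (\<lambda>x. (?T f x)\<^sup>2 * (?T c x)\<^sup>2)) x \<le> \<Gamma> * Av N (\<lambda>x. (c x)\<^sup>2) x"
      by (rule insert.IH) (use fin NM i hyp indci in \<open>auto simp: Av_insert'\<close>)
    then show ?thesis using fin i by (simp add: Av_insert')
  qed
  let ?Q = "\<lambda>x. (4/9 * (?T a x)\<^sup>2 + 1/27 * (?T b x)\<^sup>2) * (?T d x)\<^sup>2"
  \<comment> \<open>Here \<open>i\<close> is neither in \<open>N\<close> nor in \<open>M\<close>; it
    is a parameter, and the bound, valid for each of its values, is averaged over \<open>i\<close>
    afterwards.\<close>
  have step2: "Av N (Av M ?Q) y \<le> \<Gamma> * Av N (\<lambda>x. (d x)\<^sup>2) y" for y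
  proof -
    have "?Q = (\<lambda>x. 4/9 * ((?T a x)\<^sup>2 * (?T d x)\<^sup>2) + 1/27 * ((?T b x)\<^sup>2 * (?T d x)\<^sup>2))"
      by (simp add: fun_eq_iff algebra_simps)
    then have "Av N (Av M ?Q) y = 4/9 * Av N (Av M (\<lambda>x. (?T a x)\<^sup>2 * (?T d x)\<^sup>2)) y
        + 1/27 * Av N (Av M (\<lambda>x. (?T b x)\<^sup>2 * (?T d x)\<^sup>2)) y"
      using fin by (simp only: noise_lin)
    also have "\<dots> \<le> 4/9 * (\<Gamma> * Av N (\<lambda>x. (d x)\<^sup>2) y) + 1/27 * ((10 * \<Gamma>) * Av N (\<lambda>x. (d x)\<^sup>2) y)"
      using fin NM hypa hypb indd by (intro add_mono mult_left_mono insert.IH) auto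
    also have "\<dots> = 22/27 * (\<Gamma> * Av N (\<lambda>x. (d x)\<^sup>2) y)"
      by simp
    also have "\<dots> \<le> \<Gamma> * Av N (\<lambda>x. (d x)\<^sup>2) y"
      using \<Gamma> fin by (intro mult_left_le_one_le mult_nonneg_nonneg noise_ge_const) auto
    finally show ?thesis .
  qed
  have "Av (insert i N) (Av M (\<lambda>x. (noise (1/3) (insert i N) f x)\<^sup>2 * (noise (1/3) (insert i N) g x)\<^sup>2)) x
      = Av N (Av M (avg i (\<lambda>x. (?T a x + ?T b x / 3)\<^sup>2 * (?T c x + ?T d x / 3)\<^sup>2))) x"
    unfolding Tf Tg using fin i by (simp add: Av_insert' noise_avg_comm)
  also have "\<dots> \<le> Av N (Av M (\<lambda>x. avg i (\<lambda>x. (?T f x)\<^sup>2 * (?T c x)\<^sup>2) x + avg i ?Q x)) x"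
  proof (intro noise_mono)
    fix y
    show "avg i (\<lambda>x. (?T a x + ?T b x / 3)\<^sup>2 * (?T c x + ?T d x / 3)\<^sup>2) y
      \<le> avg i (\<lambda>x. (?T f x)\<^sup>2 * (?T c x)\<^sup>2) y + avg i ?Q y"
      unfolding Tfab
      by (rule avg_two_point)
        (use fin in \<open>auto simp: a_def b_def c_def d_def avg_noise_centered intro!: indep_noise indep_avg\<close>)
  qed (use fin in auto)
  also have "\<dots> = Av N (Av M (avg i (\<lambda>x. (?T f x)\<^sup>2 * (?T c x)\<^sup>2))) x + avg i (Av N (Av M ?Q)) x"
    using fin by (simp add: noise_add noise_avg_comm)
  also have "\<dots> \<le> \<Gamma> * Av N (\<lambda>x. (c x)\<^sup>2) x + avg i (\<lambda>y. \<Gamma> * Av N (\<lambda>x. (d x)\<^sup>2) y) x"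
    by (intro add_mono step1 avg_mono step2)
  also have "avg i (\<lambda>y. \<Gamma> * Av N (\<lambda>x. (d x)\<^sup>2) y) x = \<Gamma> * Av N (avg i (\<lambda>x. (d x)\<^sup>2)) x"
    using fin avg_lin[of i \<Gamma> "Av N (\<lambda>x. (d x)\<^sup>2)" 0 "\<lambda>x. 0" x] by (simp add: noise_avg_comm)
  also have "\<Gamma> * Av N (\<lambda>x. (c x)\<^sup>2) x + \<Gamma> * Av N (avg i (\<lambda>x. (d x)\<^sup>2)) x
      = \<Gamma> * Av N (\<lambda>x. (c x)\<^sup>2 + avg i (\<lambda>x. (d x)\<^sup>2) x) x"
    using fin by (simp add: noise_add algebra_simps)
  also have "(\<lambda>x. (c x)\<^sup>2 + avg i (\<lambda>x. (d x)\<^sup>2) x) = avg i (\<lambda>x. (g x)\<^sup>2)"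
    by (simp add: fun_eq_iff c_def d_def flip: avg_square_decomp)
  also have "Av N (avg i (\<lambda>x. (g x)\<^sup>2)) x = Av (insert i N) (\<lambda>x. (g x)\<^sup>2) x"
    using fin i by (simp add: Av_insert')
  finally show ?case .
qed

text \<open>Log-convexity of moments for the exponents 1, 2, 4. Two applications of Cauchy-Schwarz
  through the third moment replace Hoelder's inequality.\<close>

lemma Av_interpolation:
  assumes "finite S" "\<And>x. 0 \<le> h x"
  shows "(Av S (\<lambda>y. (h y)\<^sup>2) x) ^ 3 \<le> (Av S h x)\<^sup>2 * Av S (\<lambda>y. (h y) ^ 4) x"
proof -
  define p q r s where "p = Av S h x" and "q = Av S (\<lambda>y. (h y)\<^sup>2) x"
    and "r = Av S (\<lambda>y. (h y) ^ 3) x" and "s = Av S (\<lambda>y. (h y) ^ 4) x"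
  have "(Av S (\<lambda>y. sqrt (h y) * (sqrt (h y) * h y)) x)\<^sup>2
      \<le> Av S (\<lambda>y. (sqrt (h y))\<^sup>2) x * Av S (\<lambda>y. (sqrt (h y) * h y)\<^sup>2) x"
    by (rule Av_Cauchy_Schwarz[OF assms(1)])
  also have "(\<lambda>y. sqrt (h y) * (sqrt (h y) * h y)) = (\<lambda>y. (h y)\<^sup>2)"
    using assms(2) by (simp add: fun_eq_iff power2_eq_square flip: mult.assoc)
  also have "(\<lambda>y. (sqrt (h y) * h y)\<^sup>2) = (\<lambda>y. (h y) ^ 3)"
    using assms(2) by (simp add: fun_eq_iff power_mult_distrib power3_eq_cube power2_eq_square)
  also have "(\<lambda>y. (sqrt (h y))\<^sup>2) = h"
    using assms(2) by simp
  finally have 1: "q\<^sup>2 \<le> p * r" by (simp add: p_def q_def r_def)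
  have "(Av S (\<lambda>y. h y * (h y)\<^sup>2) x)\<^sup>2 \<le> Av S (\<lambda>y. (h y)\<^sup>2) x * Av S (\<lambda>y. ((h y)\<^sup>2)\<^sup>2) x"
    by (rule Av_Cauchy_Schwarz[OF assms(1)])
  then have 2: "r\<^sup>2 \<le> q * s"
    by (simp add: q_def r_def s_def power3_eq_cube power2_eq_square power4_eq_xxxx mult.assoc)
  have nn: "0 \<le> p" "0 \<le> q" "0 \<le> r" "0 \<le> s"
    using assms by (auto simp: p_def q_def r_def s_def intro!: noise_ge_const)
  have "(q\<^sup>2)\<^sup>2 \<le> (p * r)\<^sup>2" using 1 nn by (intro power_mono) auto
  also have "\<dots> = p\<^sup>2 * r\<^sup>2" by (simp add: power_mult_distrib)
  also have "\<dots> \<le> p\<^sup>2 * (q * s)" using 2 by (intro mult_left_mono) auto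
  finally have 3: "q * q ^ 3 \<le> q * (p\<^sup>2 * s)" by (simp add: eval_nat_numeral algebra_simps)
  show ?thesis
  proof (cases "q = 0")
    case True
    then show ?thesis using nn by (simp add: p_def q_def s_def)
  next
    case False
    then have "q ^ 3 \<le> p\<^sup>2 * s" using 3 nn by (simp add: mult_le_cancel_left)
    then show ?thesis by (simp add: p_def q_def s_def)
  qed
qed


text \<open>Improves the bound \<open>\<Gamma>\<close> on the squared norm towards \<open>\<mu>\<^sup>2\<close>, its least possible value.\<close>
lemma noise_third_global:
  assumes "finite N" "\<And>x. 0 \<le> g x" "S \<subseteq> N"
    and L1: "\<And>S x. S \<subseteq> N \<Longrightarrow> Av (N - S) g x \<le> 2 ^ card S * \<mu>"
    and L2: "\<And>S x. S \<subseteq> N \<Longrightarrow> Av (N - S) (\<lambda>x. (g x)\<^sup>2) x \<le> 4 ^ card S * \<Gamma>"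
    and "\<Gamma>' ^ 3 = \<mu>\<^sup>2 * \<Gamma>\<^sup>2" "0 \<le> \<Gamma>'"
  shows "Av (N - S) (noise (1/3) N g) x \<le> 2 ^ card S * \<mu>"
    and "Av (N - S) (\<lambda>x. (noise (1/3) N g x)\<^sup>2) x \<le> 4 ^ card S * \<Gamma>'"
proof -
  have fin: "finite S" "finite (N - S)" using assms finite_subset by auto
  \<comment> \<open>Noise in the fixed coordinates \<open>S\<close> only mixes restrictions that
    obey a common bound and does no harm; noise in the free coordinates \<open>N - S\<close> is what
    hypercontractivity requires.\<close>
  define u where "u = noise (1/3) S g"
  define w where "w = noise (1/3) (N - S) u"
  have N: "N = (N - S) \<union> S" using assms by auto
  have w: "noise (1/3) N g = w"
    using noise_Un[of "N - S" S "1/3" g] fin N by (auto simp: w_def u_def)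
  have unn: "0 \<le> u x" for x unfolding u_def using fin assms by (intro noise_ge_const) auto
  have wnn: "0 \<le> w x" for x unfolding w_def using fin unn by (intro noise_ge_const) auto
  have "Av (N - S) w x = noise (1/3) S (Av (N - S) g) x"
    unfolding w_def u_def using fin noise_comm[of "N - S" S 0 "1/3" g]
    by (subst Av_subset_noise) auto
  also have "\<dots> \<le> 2 ^ card S * \<mu>"
    using fin assms by (intro noise_le_const L1) auto
  finally have w1: "Av (N - S) w x \<le> 2 ^ card S * \<mu>" .
  then show "Av (N - S) (noise (1/3) N g) x \<le> 2 ^ card S * \<mu>" by (simp add: w)
  have u2: "Av (N - S - U) (\<lambda>x. (u x)\<^sup>2) y \<le> 4 ^ card U * (4 ^ card S * \<Gamma>)"
    if U: "U \<subseteq> N - S" for U y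
  proof -
    have "Av (N - S - U) (\<lambda>x. (u x)\<^sup>2) y
        \<le> Av (N - S - U) (noise (1/3) S (\<lambda>x. (g x)\<^sup>2)) y"
      unfolding u_def using fin by (intro noise_mono noise_Jensen) auto
    also have "\<dots> = noise (1/3) S (Av (N - S - U) (\<lambda>x. (g x)\<^sup>2)) y"
      using fin by (simp add: noise_comm)
    also have "\<dots> \<le> 4 ^ card (S \<union> U) * \<Gamma>"
    proof (rule noise_le_const)
      have "N - (S \<union> U) = N - S - U" by auto
      then show "Av (N - S - U) (\<lambda>x. (g x)\<^sup>2) z \<le> 4 ^ card (S \<union> U) * \<Gamma>" for z
        using L2[of "S \<union> U" z] U assms(3) by auto
    qed (use fin in auto)
    also have "card (S \<union> U) = card U + card S"
      using U fin finite_subset[of U "N - S"] by (subst card_Un_disjoint) auto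
    finally show ?thesis by (simp add: power_add)
  qed
  define \<Lambda> where "\<Lambda> = 4 ^ card S * \<Gamma>"
  have u2': "Av (N - S) (\<lambda>x. (u x)\<^sup>2) x \<le> \<Lambda>"
    using u2[of "{}" x] by (simp add: \<Lambda>_def)
  have "0 \<le> Av (N - S) (\<lambda>x. (u x)\<^sup>2) x" using fin by (intro noise_ge_const) auto
  with u2' have \<Lambda>: "0 \<le> \<Lambda>" by simp
  have "Av (N - S) (\<lambda>x. (w x) ^ 4) x = Av (N - S) (Av {} (\<lambda>x. (w x)\<^sup>2 * (w x)\<^sup>2)) x"
    by (simp add: power4_eq_xxxx power2_eq_square mult.assoc)
  also have "\<dots> \<le> \<Lambda> * Av (N - S) (\<lambda>x. (u x)\<^sup>2) x"
    unfolding w_def \<Lambda>_def by (rule hypercontractive) (use fin u2 in auto)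
  also have "\<dots> \<le> \<Lambda> * \<Lambda>"
    using u2' \<Lambda> by (rule mult_left_mono)
  finally have w4: "Av (N - S) (\<lambda>x. (w x) ^ 4) x \<le> \<Lambda>\<^sup>2" by (simp add: power2_eq_square)
  have w1nn: "0 \<le> Av (N - S) w x" using fin wnn by (intro noise_ge_const) auto
  have "(Av (N - S) (\<lambda>x. (w x)\<^sup>2) x) ^ 3
      \<le> (Av (N - S) w x)\<^sup>2 * Av (N - S) (\<lambda>x. (w x) ^ 4) x"
    using fin wnn by (intro Av_interpolation) auto
  also have "\<dots> \<le> (2 ^ card S * \<mu>)\<^sup>2 * \<Lambda>\<^sup>2"
    using w1 w1nn w4 wnn fin by (intro mult_mono power_mono noise_ge_const) auto
  also have "\<dots> = (2 ^ card S)\<^sup>2 * (4 ^ card S)\<^sup>2 * (\<mu>\<^sup>2 * \<Gamma>\<^sup>2)"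
    by (simp add: \<Lambda>_def power_mult_distrib)
  \<comment> \<open>The growth rates 2 and 4 reproduce themselves, since
    \<open>2^2 * 4^2 = 4^3\<close>. Hence the smoothed function satisfies hypotheses of the same
    form and the step can be iterated.\<close>
  also have "(2 ^ card S)\<^sup>2 * (4 ^ card S)\<^sup>2 = ((4 ^ card S) ^ 3 :: real)"
    by (simp add: power2_eq_square power3_eq_cube flip: power_mult_distrib)
  also have "(4 ^ card S) ^ 3 * (\<mu>\<^sup>2 * \<Gamma>\<^sup>2) = (4 ^ card S * \<Gamma>') ^ 3"
    by (simp add: power_mult_distrib assms)
  finally have "Av (N - S) (\<lambda>x. (w x)\<^sup>2) x \<le> 4 ^ card S * \<Gamma>'"
    by (rule power_le_imp_le_base[of _ "Suc (Suc 0)", folded numeral_3_eq_3])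
      (use assms in auto)
  then show "Av (N - S) (\<lambda>x. (noise (1/3) N g x)\<^sup>2) x \<le> 4 ^ card S * \<Gamma>'"
    by (simp add: w)
qed

text \<open>Each coordinate is kept with probability \<open>\<sigma>\<close>, and a kept one costs
  at most a factor \<open>K\<close>; the expected cost per coordinate is
  \<open>1 + \<sigma> K - \<sigma>\<close>. The choice \<open>\<sigma> = 1/K\<close> turns the
  growth rate \<open>K\<close> into 2.\<close>

lemma noise_le_of_global:
  assumes "finite S" "0 \<le> \<sigma>" "\<sigma> \<le> 1" "0 \<le> \<mu>" "0 \<le> K"
    and "\<And>U x. U \<subseteq> S \<Longrightarrow> Av (S - U) f x \<le> K ^ card U * \<mu>"
  shows "noise \<sigma> S f x \<le> (1 + \<sigma> * K) ^ card S * \<mu>"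
  using assms(1,4,6)
proof (induction S arbitrary: f \<mu> x rule: finite_induct)
  case empty
  then show ?case by simp
next
  case (insert i S)
  have "noise \<sigma> (insert i S) f = noise \<sigma> S (\<lambda>x. \<sigma> * f x + (1 - \<sigma>) * avg i f x)"
    using insert by (simp add: noise_insert' noise1_def[abs_def])
  then have "noise \<sigma> (insert i S) f x = \<sigma> * noise \<sigma> S f x + (1 - \<sigma>) * noise \<sigma> S (avg i f) x"
    using insert by (simp add: noise_lin)
  also have "\<dots> \<le> \<sigma> * ((1 + \<sigma> * K) ^ card S * (K * \<mu>)) + (1 - \<sigma>) * ((1 + \<sigma> * K) ^ card S * \<mu>)"
  proof (intro add_mono mult_left_mono)
    show "noise \<sigma> S f x \<le> (1 + \<sigma> * K) ^ card S * (K * \<mu>)"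
    proof (rule insert.IH)
      fix U y assume U: "U \<subseteq> S"
      have "insert i S - insert i U = S - U" "card (insert i U) = Suc (card U)"
        using U insert.hyps finite_subset[OF U] by (auto intro!: card_insert_disjoint)
      then show "Av (S - U) f y \<le> K ^ card U * (K * \<mu>)"
        using insert.prems(2)[of "insert i U" y] U by (auto simp: mult_ac)
    qed (use assms insert in auto)
    show "noise \<sigma> S (avg i f) x \<le> (1 + \<sigma> * K) ^ card S * \<mu>"
    proof (rule insert.IH)
      fix U y assume U: "U \<subseteq> S"
      have "insert i S - U = insert i (S - U)" using U insert.hyps by auto
      then show "Av (S - U) (avg i f) y \<le> K ^ card U * \<mu>"
        using insert.prems(2)[of U y] U insert.hyps by (auto simp: Av_insert')
    qed (use insert in auto)
  qed (use assms in auto)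
  also have "\<dots> = (1 + \<sigma> * K - \<sigma>) * ((1 + \<sigma> * K) ^ card S * \<mu>)"
    by (simp add: algebra_simps)
  also have "\<dots> \<le> (1 + \<sigma> * K) * ((1 + \<sigma> * K) ^ card S * \<mu>)"
    using assms insert by (intro mult_right_mono) auto
  finally show ?case using insert by (simp add: mult.assoc)
qed

text \<open>The smoothing by \<open>1/K\<close> brings the growth rate from \<open>K\<close> down to
  the 2 that \<open>noise_third_global\<close> can process. As \<open>f \<le> 1\<close>, second
  moments are bounded by first moments, so the ratio to \<open>\<mu>^2\<close> starts below
  \<open>1/\<mu> \<le> B\<close>; each of the \<open>j\<close> smoothings by 1/3 raises this bound
  to the power 2/3.\<close>

lemma noise_level_inequality:
  assumes "finite N" "\<And>x. 0 \<le> f x" "\<And>x. f x \<le> 1" "1 \<le> K" "0 < \<mu>" "1 / \<mu> \<le> B"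
    and glob: "\<And>S x. S \<subseteq> N \<Longrightarrow> Av (N - S) f x \<le> K ^ card S * \<mu>"
  shows "Av N (\<lambda>x. (noise ((1/3) ^ j / K) N f x)\<^sup>2) x \<le> \<mu>\<^sup>2 * B powr ((2/3) ^ j)"
proof -
  let ?h = "\<lambda>j. noise ((1/3) ^ j / K) N f"
  have "0 < 1 / \<mu>" using assms by simp
  then have B: "0 < B" using assms by linarith
  have range: "0 \<le> (1/3) ^ j / K" "(1/3) ^ j / K \<le> 1" for j
    using assms power_le_one[of "1/3::real" j] by (auto simp: divide_le_eq)
  have nn: "0 \<le> ?h j x" for j x
    using assms range by (intro noise_ge_const) auto
  have "(\<forall>S x. S \<subseteq> N \<longrightarrow> Av (N - S) (?h j) x \<le> 2 ^ card S * \<mu>) \<and>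
    (\<forall>S x. S \<subseteq> N \<longrightarrow> Av (N - S) (\<lambda>x. (?h j x)\<^sup>2) x \<le> 4 ^ card S * (\<mu>\<^sup>2 * B powr ((2/3) ^ j)))"
  proof (induction j)
    case 0
    have L1: "Av (N - S) (?h 0) x \<le> 2 ^ card S * \<mu>" if "S \<subseteq> N" for S x
    proof -
      have fin: "finite S" "finite (N - S)" using assms that finite_subset by auto
      have "N = (N - S) \<union> S" using that by auto
      then have "?h 0 = noise (1/K) (N - S) (noise (1/K) S f)"
        using noise_Un[of "N - S" S "1/K" f] fin by auto
      then have "Av (N - S) (?h 0) x = noise (1/K) S (Av (N - S) f) x"
        using fin noise_comm[of "N - S" S 0 "1/K" f] by (simp add: Av_subset_noise)
      also have "\<dots> \<le> (1 + 1/K * K) ^ card S * \<mu>"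
      proof (rule noise_le_of_global)
        fix U y assume U: "U \<subseteq> S"
        have "Av (S - U) (Av (N - S) f) = Av ((S - U) \<union> (N - S)) f"
          using fin by (subst noise_Un) auto
        also have "(S - U) \<union> (N - S) = N - U" using U that by auto
        finally show "Av (S - U) (Av (N - S) f) y \<le> K ^ card U * \<mu>"
          using glob[of U y] U that by auto
      qed (use assms fin in auto)
      finally show ?thesis using assms by simp
    qed
    have "Av (N - S) (\<lambda>x. (?h 0 x)\<^sup>2) x \<le> 4 ^ card S * (\<mu>\<^sup>2 * B powr ((2/3) ^ 0))"
      if "S \<subseteq> N" for S x
    proof -
      have "?h 0 y \<le> 1" for y using assms range[of 0] by (intro noise_le_const) auto
      then have "Av (N - S) (\<lambda>x. (?h 0 x)\<^sup>2) x \<le> Av (N - S) (?h 0) x"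
        using nn[of 0] assms by (intro noise_mono) (auto simp: power2_eq_square mult_left_le)
      also have "\<dots> \<le> 2 ^ card S * \<mu>" using L1 that by blast
      also have "\<dots> \<le> 4 ^ card S * \<mu>" using assms by (intro mult_right_mono power_mono) auto
      also have "\<mu> \<le> \<mu>\<^sup>2 * B"
        using assms by (simp add: power2_eq_square field_simps)
      finally show ?thesis using B by simp
    qed
    then show ?case using L1 by blast
  next
    case (Suc j)
    let ?\<Gamma> = "\<lambda>j. \<mu>\<^sup>2 * B powr ((2/3) ^ j)"
    have eq: "?h (Suc j) = noise (1/3) N (?h j)"
      using assms by (simp add: noise_noise)
    have "(?\<Gamma> (Suc j)) ^ 3 = \<mu> ^ 6 * B powr (3 * (2/3) ^ Suc j)"
      using B by (simp add: power_mult_distrib powr_power mult.commute)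
    also have "3 * (2/3 :: real) ^ Suc j = 2 * (2/3) ^ j" by simp
    also have "\<mu> ^ 6 * B powr (2 * (2/3) ^ j) = \<mu>\<^sup>2 * (?\<Gamma> j)\<^sup>2"
      using B by (simp add: power_mult_distrib powr_power mult.commute flip: power_add power_mult)
    finally have \<Gamma>: "(?\<Gamma> (Suc j)) ^ 3 = \<mu>\<^sup>2 * (?\<Gamma> j)\<^sup>2" .
    show ?case
      unfolding eq using Suc.IH nn assms \<Gamma>
      by (intro conjI allI impI noise_third_global[where \<mu> = \<mu> and \<Gamma> = "?\<Gamma> j"]) auto
  qed
  from this[THEN conjunct2, rule_format, of "{}" x] show ?thesis by simp
qed

text \<open>For negative \<open>r\<close> the kernel need not be positive, so
  \<open>noise_Jensen\<close> does not apply. Instead each coordinate splits the function into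
  orthogonal parts, its mean and the centered remainder, and only the latter is scaled by
  \<open>r\<close>.\<close>

lemma noise_contraction:
  assumes "finite N" "\<bar>r\<bar> \<le> 1"
  shows "Av N (\<lambda>x. (noise r N g x)\<^sup>2) x \<le> Av N (\<lambda>x. (g x)\<^sup>2) x"
  using assms(1)
proof (induction N arbitrary: g x rule: finite_induct)
  case (insert i N)
  let ?T = "noise r N"
  define d where "d = (\<lambda>x. g x - avg i g x)"
  have avg0: "avg i (?T d) x = 0" for x
    unfolding d_def using insert by (intro avg_noise_centered) auto
  have ind: "indep i (?T (avg i g))" using insert by (intro indep_noise indep_avg) auto
  have T: "noise r (insert i N) g = (\<lambda>x. ?T (avg i g) x + r * ?T d x)"
    unfolding d_def using insert by (intro noise_insert_decomp)
  have pt: "avg i (\<lambda>x. (noise r (insert i N) g x)\<^sup>2) y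
      \<le> (?T (avg i g) y)\<^sup>2 + avg i (\<lambda>x. (?T d x)\<^sup>2) y" for y
  proof -
    have "avg i (\<lambda>x. ?T (avg i g) x + r * ?T d x) x = ?T (avg i g) x" for x
      using avg_lin[of i 1 "?T (avg i g)" r "?T d" x] avg0 avg_indep[OF ind] by simp
    then have "avg i (\<lambda>x. (?T (avg i g) x + r * ?T d x)\<^sup>2) y
        = (?T (avg i g) y)\<^sup>2 + r\<^sup>2 * avg i (\<lambda>x. (?T d x)\<^sup>2) y"
      using avg_square_decomp[of i "\<lambda>x. ?T (avg i g) x + r * ?T d x" y]
        avg_lin[of i "r\<^sup>2" "\<lambda>x. (?T d x)\<^sup>2" 0 "\<lambda>x. 0" y]
      by (simp add: power_mult_distrib)
    moreover have "r\<^sup>2 * avg i (\<lambda>x. (?T d x)\<^sup>2) y \<le> 1 * avg i (\<lambda>x. (?T d x)\<^sup>2) y"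
    proof (rule mult_right_mono)
      show "r\<^sup>2 \<le> 1" using assms(2) by (simp add: abs_square_le_1)
      show "0 \<le> avg i (\<lambda>x. (?T d x)\<^sup>2) y"
        using avg_mono[of "\<lambda>x. 0" "\<lambda>x. (?T d x)\<^sup>2" i y] by simp
    qed
    ultimately show ?thesis by (simp add: T)
  qed
  have "Av (insert i N) (\<lambda>x. (noise r (insert i N) g x)\<^sup>2) x
      \<le> Av N (\<lambda>y. (?T (avg i g) y)\<^sup>2 + avg i (\<lambda>x. (?T d x)\<^sup>2) y) x"
    using insert pt by (subst Av_insert') (auto intro!: noise_mono)
  also have "\<dots> = Av N (\<lambda>y. (?T (avg i g) y)\<^sup>2) x + avg i (Av N (\<lambda>x. (?T d x)\<^sup>2)) x"
    using insert by (simp add: noise_add noise_avg_comm)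
  also have "\<dots> \<le> Av N (\<lambda>y. (avg i g y)\<^sup>2) x + avg i (Av N (\<lambda>x. (d x)\<^sup>2)) x"
    by (intro add_mono avg_mono insert.IH)
  also have "\<dots> = Av N (\<lambda>y. (avg i g y)\<^sup>2 + avg i (\<lambda>x. (d x)\<^sup>2) y) x"
    using insert by (simp add: noise_add noise_avg_comm)
  also have "\<dots> = Av (insert i N) (\<lambda>x. (g x)\<^sup>2) x"
    using insert by (simp add: Av_insert' d_def flip: avg_square_decomp)
  finally show ?case .
qed simp

text \<open>The natural error is \<open>|r|\<close> times the product of the L2 norms. Half the sum
  of the squares, larger by AM-GM, is better suited to induction: by orthogonality the second
  moments add up over the means and the centered parts, and only centered parts produce an
  error.\<close>

lemma noise_correlation:
  assumes "finite N" "\<bar>r\<bar> \<le> 1"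
  shows "Av N f x * Av N g x - \<bar>r\<bar> / 2 * (Av N (\<lambda>x. (f x)\<^sup>2) x + Av N (\<lambda>x. (g x)\<^sup>2) x)
    \<le> Av N (\<lambda>x. f x * noise r N g x) x"
  using assms(1)
proof (induction N arbitrary: f g x rule: finite_induct)
  case (insert i N)
  let ?T = "noise r N"
  define b where "b = (\<lambda>x. f x - avg i f x)"
  define d where "d = (\<lambda>x. g x - avg i g x)"
  have T: "noise r (insert i N) g = (\<lambda>x. ?T (avg i g) x + r * ?T d x)"
    unfolding d_def using insert by (intro noise_insert_decomp)
  have avgd: "avg i (?T d) x = 0" for x
    unfolding d_def using insert by (intro avg_noise_centered) auto
  have ind: "indep i (?T (avg i g))" using insert by (intro indep_noise indep_avg) auto
  have pt: "avg i f y * ?T (avg i g) y - \<bar>r\<bar> / 2 * (avg i (\<lambda>x. (b x)\<^sup>2) y + avg i (\<lambda>x. (?T d x)\<^sup>2) y)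
      \<le> avg i (\<lambda>x. f x * noise r (insert i N) g x) y" for y
  proof -
    have "avg i (\<lambda>x. 1 * (?T (avg i g) x * f x)
          + 1 * (r * (avg i f x * ?T d x) + (- \<bar>r\<bar> / 2) * (1 * (b x)\<^sup>2 + 1 * (?T d x)\<^sup>2))) y
        \<le> avg i (\<lambda>x. f x * noise r (insert i N) g x) y"
    proof (rule avg_mono)
      fix z
      have "- (\<bar>r\<bar> / 2) * ((b z)\<^sup>2 + (?T d z)\<^sup>2) \<le> r * (b z * ?T d z)"
      proof (cases "0 \<le> r")
        case True
        have "0 \<le> r * (b z + ?T d z)\<^sup>2" using True by simp
        with True show ?thesis by (simp add: power2_eq_square algebra_simps)
      next
        case False
        have "0 \<le> (- r) * (b z - ?T d z)\<^sup>2" using False by (intro mult_nonneg_nonneg) auto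
        with False show ?thesis by (simp add: power2_eq_square algebra_simps)
      qed
      then show "1 * (?T (avg i g) z * f z)
          + 1 * (r * (avg i f z * ?T d z) + (- \<bar>r\<bar> / 2) * (1 * (b z)\<^sup>2 + 1 * (?T d z)\<^sup>2))
        \<le> f z * noise r (insert i N) g z"
        by (simp add: T b_def algebra_simps)
    qed
    also have "avg i (\<lambda>x. 1 * (?T (avg i g) x * f x)
          + 1 * (r * (avg i f x * ?T d x) + (- \<bar>r\<bar> / 2) * (1 * (b x)\<^sup>2 + 1 * (?T d x)\<^sup>2))) y
        = ?T (avg i g) y * avg i f y
          + (- \<bar>r\<bar> / 2) * (avg i (\<lambda>x. (b x)\<^sup>2) y + avg i (\<lambda>x. (?T d x)\<^sup>2) y)"
      unfolding avg_lin avg_indep_mult[OF ind] avg_indep_mult[OF indep_avg] avgd by simp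
    finally show ?thesis by (simp add: mult.commute)
  qed
  have "Av N (avg i f) x * Av N (avg i g) x
      - \<bar>r\<bar> / 2 * (Av N (\<lambda>x. (avg i f x)\<^sup>2) x + Av N (\<lambda>x. (avg i g x)\<^sup>2) x)
    \<le> Av N (\<lambda>x. avg i f x * ?T (avg i g) x) x"
    by (rule insert.IH)
  moreover have "Av N (\<lambda>y. avg i f y * ?T (avg i g) y
      + (- \<bar>r\<bar> / 2) * (1 * avg i (\<lambda>x. (b x)\<^sup>2) y + 1 * avg i (\<lambda>x. (?T d x)\<^sup>2) y)) x
    \<le> Av (insert i N) (\<lambda>x. f x * noise r (insert i N) g x) x"
    using insert pt by (subst Av_insert') (auto intro!: noise_mono)
  moreover have "Av N (\<lambda>y. avg i f y * ?T (avg i g) y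
      + (- \<bar>r\<bar> / 2) * (1 * avg i (\<lambda>x. (b x)\<^sup>2) y + 1 * avg i (\<lambda>x. (?T d x)\<^sup>2) y)) x
    = Av N (\<lambda>y. avg i f y * ?T (avg i g) y) x
      + (- \<bar>r\<bar> / 2) * (Av N (avg i (\<lambda>x. (b x)\<^sup>2)) x + avg i (Av N (\<lambda>x. (?T d x)\<^sup>2)) x)"
    unfolding noise_add[OF insert.hyps(1)] noise_cmult[OF insert.hyps(1)] noise_lin[OF insert.hyps(1)]
    using insert by (simp add: noise_avg_comm)
  moreover have "\<bar>r\<bar> / 2 * avg i (Av N (\<lambda>x. (?T d x)\<^sup>2)) x \<le> \<bar>r\<bar> / 2 * avg i (Av N (\<lambda>x. (d x)\<^sup>2)) x"
    using insert assms(2) by (intro mult_left_mono avg_mono noise_contraction) auto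
  moreover have sq: "Av (insert i N) (\<lambda>x. (h x)\<^sup>2) x
      = Av N (\<lambda>x. (avg i h x)\<^sup>2) x + Av N (avg i (\<lambda>x. (h x - avg i h x)\<^sup>2)) x" for h
  proof -
    have "avg i (\<lambda>x. (h x)\<^sup>2) = (\<lambda>x. (avg i h x)\<^sup>2 + avg i (\<lambda>x. (h x - avg i h x)\<^sup>2) x)"
      by (rule ext) (rule avg_square_decomp)
    then show ?thesis using insert by (simp add: Av_insert' noise_add)
  qed
  ultimately show ?case
    unfolding sq using insert by (simp add: Av_insert' noise_avg_comm b_def d_def algebra_simps)
qed simp

text \<open>For \<open>\<rho> = -1/(m - 1)\<close> the weight \<open>\<rho> + (1 - \<rho>)/m\<close>
  of the current value is 0. The operator thus averages uniformly over the other
  \<open>m - 1\<close> values of each coordinate, and a positive average has a positive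
  term.\<close>

lemma noise_disagree_witness:
  assumes "2 \<le> m" "finite N" "0 < noise (- 1 / (real m - 1)) N g x" "\<And>i. i \<in> N \<Longrightarrow> x i < m"
  shows "\<exists>y. (\<forall>i\<in>N. y i < m \<and> y i \<noteq> x i) \<and> (\<forall>i. i \<notin> N \<longrightarrow> y i = x i) \<and> 0 < g y"
  using assms(2-)
proof (induction N arbitrary: x rule: finite_induct)
  case empty
  then show ?case by auto
next
  case (insert i N)
  define h where "h = noise (- 1 / (real m - 1)) N g"
  have xi: "x i < m" using insert by auto
  have "noise (- 1 / (real m - 1)) (insert i N) g x
      = - 1 / (real m - 1) * h x + (1 + 1 / (real m - 1)) * ((\<Sum>a<m. h (x(i := a))) / real m)"
    using insert by (simp add: noise_insert noise1_def avg_def h_def)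
  also have "(1 + 1 / (real m - 1)) = real m / (real m - 1)"
    using assms(1) by (simp add: field_simps)
  also have "(\<Sum>a<m. h (x(i := a))) = h x + (\<Sum>a\<in>{..<m} - {x i}. h (x(i := a)))"
    using xi by (subst sum.remove[of _ "x i"]) auto
  also have "- 1 / (real m - 1) * h x
      + real m / (real m - 1) * ((h x + (\<Sum>a\<in>{..<m} - {x i}. h (x(i := a)))) / real m)
      = (\<Sum>a\<in>{..<m} - {x i}. h (x(i := a))) / (real m - 1)"
    using m_pos by (simp add: add_divide_distrib distrib_left)
  finally have "0 < (\<Sum>a\<in>{..<m} - {x i}. h (x(i := a))) / (real m - 1)"
    using insert.prems by simp
  then have "0 < (\<Sum>a\<in>{..<m} - {x i}. h (x(i := a)))"
    using assms(1) by (simp add: zero_less_divide_iff)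
  then obtain a where a: "a < m" "a \<noteq> x i" "0 < h (x(i := a))"
    by (metis (no_types, lifting) DiffE insertI1 lessThan_iff not_less sum_nonpos)
  have "\<exists>y. (\<forall>j\<in>N. y j < m \<and> y j \<noteq> (x(i := a)) j) \<and> (\<forall>j. j \<notin> N \<longrightarrow> y j = (x(i := a)) j) \<and> 0 < g y"
  proof (rule insert.IH)
    show "0 < noise (- 1 / (real m - 1)) N g (x(i := a))" using a(3) by (simp only: h_def)
    show "(x(i := a)) j < m" if "j \<in> N" for j using that insert.prems(2) a by simp
  qed
  then obtain y where y: "\<forall>j\<in>N. y j < m \<and> y j \<noteq> (x(i := a)) j"
      "\<forall>j. j \<notin> N \<longrightarrow> y j = (x(i := a)) j" "0 < g y" by blast
  have "y i = a" using y(2) insert.hyps by simp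
  have "\<forall>j\<in>insert i N. y j < m \<and> y j \<noteq> x j"
    using y(1) \<open>y i = a\<close> a insert.hyps by (metis fun_upd_other insert_iff)
  moreover have "\<forall>j. j \<notin> insert i N \<longrightarrow> y j = x j"
    using y(2) by auto
  ultimately show ?case using y(3) by blast
qed

lemma disagreeing_pair:
  fixes f g :: "(nat \<Rightarrow> nat) \<Rightarrow> real"
  assumes "finite N" "2 \<le> m" "1 \<le> K" "0 < \<mu>" "0 < \<nu>" "1 / \<mu> \<le> B" "1 / \<nu> \<le> B"
    and f: "\<And>x. 0 \<le> f x" "\<And>x. f x \<le> 1" "\<And>S x. S \<subseteq> N \<Longrightarrow> Av (N - S) f x \<le> K ^ card S * \<mu>"
      "\<mu> \<le> Av N f x0"
    and g: "\<And>x. 0 \<le> g x" "\<And>x. g x \<le> 1" "\<And>S x. S \<subseteq> N \<Longrightarrow> Av (N - S) g x \<le> K ^ card S * \<nu>"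
      "\<nu> \<le> Av N g x0"
    and large: "9 ^ j * K\<^sup>2 * B powr ((2/3) ^ j) < real m - 1"
  shows "\<exists>x y. (\<forall>i\<in>N. x i < m \<and> y i < m \<and> x i \<noteq> y i) \<and> (\<forall>i. i \<notin> N \<longrightarrow> x i = x0 i \<and> y i = x0 i)
    \<and> 0 < f x \<and> 0 < g y"
proof -
  define \<beta> where "\<beta> = B powr ((2/3) ^ j)"
  define \<tau> where "\<tau> = (1/3) ^ j / K"
  \<comment> \<open>Chosen to satisfy \<open>\<tau> * r * \<tau> = -1/(m - 1)\<close>. The
    assumption \<open>large\<close> then says \<open>|r| * \<beta> < 1\<close>: the error stays
    below the main term.\<close>
  define r where "r = - (9 ^ j * K\<^sup>2 / (real m - 1))"
  define F where "F = noise \<tau> N f"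
  define G where "G = noise \<tau> N g"
  have m1: "0 < real m - 1" using assms(2) by simp
  have "\<mu> \<le> 1" using f(4) noise_le_const[of N 0 f 1 x0] f(2) assms(1) by auto
  then have "1 \<le> 1 / \<mu>" using assms by simp
  then have "1 \<le> B" using assms by linarith
  then have \<beta>1: "1 \<le> \<beta>" unfolding \<beta>_def by (intro ge_one_powr_ge_zero) auto
  have abs_r: "\<bar>r\<bar> = 9 ^ j * K\<^sup>2 / (real m - 1)" using m1 by (simp add: r_def)
  have r\<beta>: "\<bar>r\<bar> * \<beta> < 1" using large m1 by (simp add: abs_r \<beta>_def field_simps)
  have "\<bar>r\<bar> * 1 \<le> \<bar>r\<bar> * \<beta>" using \<beta>1 by (intro mult_left_mono) auto
  then have r1: "\<bar>r\<bar> \<le> 1" using r\<beta> by linarith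
  have "\<tau> * r * \<tau> = - 1 / (real m - 1) * ((1/3) ^ j * (1/3) ^ j * 9 ^ j)"
    using assms(3) m1 by (simp add: \<tau>_def r_def power2_eq_square field_simps)
  also have "(1/3) ^ j * (1/3) ^ j * 9 ^ j = (1 :: real)"
    by (simp flip: power_mult_distrib)
  finally have rr: "\<tau> * r * \<tau> = - 1 / (real m - 1)" by simp
  have "noise (\<tau> * r * \<tau>) N g = noise \<tau> N (noise r N G)"
    using assms(1) by (simp add: G_def noise_noise mult.assoc)
  then have corr: "Av N (\<lambda>x. f x * noise (- 1 / (real m - 1)) N g x) x0 = Av N (\<lambda>x. F x * noise r N G x) x0"
    using noise_selfadjoint[OF assms(1) order_refl, of f \<tau> "noise r N G"] by (simp add: rr F_def)
  have F1: "\<mu> \<le> Av N F x0" and G1: "\<nu> \<le> Av N G x0"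
    using f(4) g(4) assms(1) by (simp_all add: F_def G_def Av_subset_noise)
  have F2: "Av N (\<lambda>x. (F x)\<^sup>2) x0 \<le> \<mu>\<^sup>2 * \<beta>"
    unfolding F_def \<tau>_def \<beta>_def by (rule noise_level_inequality) (use assms in auto)
  have G2: "Av N (\<lambda>x. (G x)\<^sup>2) x0 \<le> \<nu>\<^sup>2 * \<beta>"
    unfolding G_def \<tau>_def \<beta>_def by (rule noise_level_inequality) (use assms in auto)
  \<comment> \<open>Both functions are normalised first: the error is a sum of second moments, not a
    product of norms, and would swamp the main term if \<open>\<mu>\<close> and \<open>\<nu>\<close>
    were of different orders.\<close>
  have "Av N (\<lambda>x. (1 / \<mu>) * F x) x0 * Av N (\<lambda>x. (1 / \<nu>) * G x) x0
      - \<bar>r\<bar> / 2 * (Av N (\<lambda>x. ((1 / \<mu>) * F x)\<^sup>2) x0 + Av N (\<lambda>x. ((1 / \<nu>) * G x)\<^sup>2) x0)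
    \<le> Av N (\<lambda>x. (1 / \<mu>) * F x * noise r N (\<lambda>x. (1 / \<nu>) * G x) x) x0"
    by (rule noise_correlation) (use assms r1 in auto)
  also have "(\<lambda>x. (1 / \<mu>) * F x * noise r N (\<lambda>x. (1 / \<nu>) * G x) x)
      = (\<lambda>x. (1 / \<mu> * (1 / \<nu>)) * (F x * noise r N G x))"
    using assms(1) by (simp only: noise_cmult) (simp add: mult_ac)
  also have "Av N \<dots> x0 = (1 / \<mu> * (1 / \<nu>)) * Av N (\<lambda>x. f x * noise (- 1 / (real m - 1)) N g x) x0"
    unfolding noise_cmult[OF assms(1)] corr ..
  also have "Av N (\<lambda>x. ((1 / \<mu>) * F x)\<^sup>2) x0 = (1 / \<mu>)\<^sup>2 * Av N (\<lambda>x. (F x)\<^sup>2) x0"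
    unfolding power_mult_distrib noise_cmult[OF assms(1)] ..
  also have "Av N (\<lambda>x. ((1 / \<nu>) * G x)\<^sup>2) x0 = (1 / \<nu>)\<^sup>2 * Av N (\<lambda>x. (G x)\<^sup>2) x0"
    unfolding power_mult_distrib noise_cmult[OF assms(1)] ..
  also have "Av N (\<lambda>x. (1 / \<mu>) * F x) x0 * Av N (\<lambda>x. (1 / \<nu>) * G x) x0
      = (1 / \<mu> * Av N F x0) * (1 / \<nu> * Av N G x0)"
    unfolding noise_cmult[OF assms(1)] ..
  finally have main: "(1 / \<mu> * Av N F x0) * (1 / \<nu> * Av N G x0)
      - \<bar>r\<bar> / 2 * ((1 / \<mu>)\<^sup>2 * Av N (\<lambda>x. (F x)\<^sup>2) x0 + (1 / \<nu>)\<^sup>2 * Av N (\<lambda>x. (G x)\<^sup>2) x0)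
    \<le> (1 / \<mu> * (1 / \<nu>)) * Av N (\<lambda>x. f x * noise (- 1 / (real m - 1)) N g x) x0" .
  have F1': "1 \<le> 1 / \<mu> * Av N F x0" and G1': "1 \<le> 1 / \<nu> * Av N G x0"
    using F1 G1 assms by (simp_all add: field_simps)
  have "1 * 1 \<le> (1 / \<mu> * Av N F x0) * (1 / \<nu> * Av N G x0)"
    using F1' G1' by (intro mult_mono) auto
  moreover have "(1 / \<mu>)\<^sup>2 * Av N (\<lambda>x. (F x)\<^sup>2) x0 \<le> \<beta>" "(1 / \<nu>)\<^sup>2 * Av N (\<lambda>x. (G x)\<^sup>2) x0 \<le> \<beta>"
    using F2 G2 assms by (simp_all add: field_simps)
  then have "\<bar>r\<bar> / 2 * ((1 / \<mu>)\<^sup>2 * Av N (\<lambda>x. (F x)\<^sup>2) x0 + (1 / \<nu>)\<^sup>2 * Av N (\<lambda>x. (G x)\<^sup>2) x0)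
      \<le> \<bar>r\<bar> / 2 * (\<beta> + \<beta>)"
    by (intro mult_left_mono add_mono) auto
  then have "\<bar>r\<bar> / 2 * ((1 / \<mu>)\<^sup>2 * Av N (\<lambda>x. (F x)\<^sup>2) x0 + (1 / \<nu>)\<^sup>2 * Av N (\<lambda>x. (G x)\<^sup>2) x0)
      \<le> \<bar>r\<bar> * \<beta>" by simp
  ultimately have "0 < (1 / \<mu> * (1 / \<nu>)) * Av N (\<lambda>x. f x * noise (- 1 / (real m - 1)) N g x) x0"
    using main r\<beta> by linarith
  then have pos: "0 < Av N (\<lambda>x. f x * noise (- 1 / (real m - 1)) N g x) x0"
    by (rule zero_less_mult_pos) (use assms in auto)
  obtain x where x: "\<And>i. i \<in> N \<Longrightarrow> x i < m" "\<And>i. i \<notin> N \<Longrightarrow> x i = x0 i"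
      "0 < f x * noise (- 1 / (real m - 1)) N g x"
    using Av_pos_witness[OF assms(1) pos] by blast
  then have fx: "0 < f x" "0 < noise (- 1 / (real m - 1)) N g x"
    using f(1)[of x] by (auto simp: zero_less_mult_iff)
  from noise_disagree_witness[OF assms(2,1) fx(2)] x(1)
  obtain y where "\<forall>i\<in>N. y i < m \<and> y i \<noteq> x i" "\<forall>i. i \<notin> N \<longrightarrow> y i = x i" "0 < g y" by blast
  then show ?thesis using x fx(1) by (intro exI[of _ x] exI[of _ y]) auto
qed

section \<open>Restricting coordinates\<close>

lemma Av_coordinate:
  assumes "finite M" "i \<in> M"
  shows "Av M (\<lambda>z. \<psi> (z i) * f z) x = (\<Sum>a<m. \<psi> a * Av (M - {i}) f (x(i := a))) / real m"
proof -
  have "Av M h = avg i (Av (M - {i}) h)" for h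
    using Av_insert[of "M - {i}" i h] assms by (simp add: insert_absorb)
  moreover have "Av (M - {i}) (\<lambda>z. \<psi> (z i) * f z) = (\<lambda>z. \<psi> (z i) * Av (M - {i}) f z)"
    using assms by (intro Av_indep_mult) (auto simp: indep_def)
  ultimately show ?thesis by (simp add: avg_def)
qed

lemma Av_prod:
  assumes "finite I"
  shows "Av I (\<lambda>z. \<Prod>i\<in>I. \<phi> i (z i)) = (\<lambda>x. \<Prod>i\<in>I. (\<Sum>a<m. \<phi> i a) / real m)"
  using assms
proof (induction I rule: finite_induct)
  case (insert i I)
  have "Av I (\<lambda>z. \<phi> i (z i) * (\<Prod>j\<in>I. \<phi> j (z j))) = (\<lambda>z. \<phi> i (z i) * Av I (\<lambda>z. \<Prod>j\<in>I. \<phi> j (z j)) z)"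
    using insert by (intro Av_indep_mult) (auto simp: indep_def)
  then show ?case
    using insert by (intro ext) (simp add: Av_insert avg_def sum_distrib_right)
qed simp

text \<open>A Chernoff bound by exponential tilting. Under the uniform measure \<open>z i\<close>
  lies in \<open>A i\<close> with probability at most 1/2, under the weight \<open>f\<close> with
  probability at least 3/4. So inserting the factor 1 + (sum of the excesses over 3/4) does not
  decrease the mean of \<open>f\<close>, while \<open>f \<le> 1\<close> bounds the result by a
  product of independent exponentials, each of mean at most
  \<open>(e^(1/4) + e^(-3/4))/2 \<le> 19/20\<close>.\<close>

lemma concentrated_mass_le:
  assumes "finite M" "I \<subseteq> M" "\<And>z. 0 \<le> f z" "\<And>z. f z \<le> 1"
    and A: "\<And>i. i \<in> I \<Longrightarrow> A i \<subseteq> {..<m}" "\<And>i. i \<in> I \<Longrightarrow> 2 * card (A i) \<le> m"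
    and conc: "\<And>i. i \<in> I \<Longrightarrow> 3/4 * Av M f x \<le> Av M (\<lambda>z. of_bool (z i \<in> A i) * f z) x"
  shows "Av M f x \<le> (19/20) ^ card I"
proof -
  have I: "finite I" using assms finite_subset by blast
  let ?b = "\<lambda>i z. of_bool (z i \<in> A i) :: real"
  let ?s = "\<lambda>z. \<Sum>i\<in>I. ?b i z - 3/4"
  let ?\<phi> = "\<lambda>i a. exp (of_bool (a \<in> A i) - 3/4) :: real"
  have "Av M f x \<le> Av M f x + (\<Sum>i\<in>I. Av M (\<lambda>z. ?b i z * f z) x - 3/4 * Av M f x)"
    using conc by (simp add: sum_nonneg)
  also have "\<dots> = Av M (\<lambda>z. f z + (\<Sum>i\<in>I. ?b i z * f z - 3/4 * f z)) x"
    unfolding noise_add[OF assms(1)] noise_sum[OF I assms(1)] noise_diff[OF assms(1)]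
      noise_cmult[OF assms(1)] ..
  also have "\<dots> \<le> Av M (\<lambda>z. \<Prod>i\<in>I. ?\<phi> i (z i)) x"
  proof (rule noise_mono)
    fix z
    have "f z + (\<Sum>i\<in>I. ?b i z * f z - 3/4 * f z) = f z * (1 + ?s z)"
      by (simp add: algebra_simps sum_distrib_left sum_subtractf)
    also have "\<dots> \<le> f z * exp (?s z)"
      using assms by (intro mult_left_mono exp_ge_add_one_self) auto
    also have "\<dots> \<le> 1 * exp (?s z)"
      using assms by (intro mult_right_mono) auto
    also have "\<dots> = (\<Prod>i\<in>I. ?\<phi> i (z i))" using I by (simp add: exp_sum)
    finally show "f z + (\<Sum>i\<in>I. ?b i z * f z - 3/4 * f z) \<le> (\<Prod>i\<in>I. ?\<phi> i (z i))" .
  qed (use assms in auto)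
  also have "\<dots> = Av ((M - I) \<union> I) (\<lambda>z. \<Prod>i\<in>I. ?\<phi> i (z i)) x"
    using assms(2) by (simp add: Un_absorb2)
  also have "\<dots> = (\<Prod>i\<in>I. (\<Sum>a<m. ?\<phi> i a) / real m)"
    using assms(1) I Av_prod[OF I, of ?\<phi>] by (subst noise_Un) auto
  also have "\<dots> \<le> (\<Prod>i\<in>I. 19/20)"
  proof (rule prod_mono, intro conjI)
    fix i assume i: "i \<in> I"
    show "0 \<le> (\<Sum>a<m. ?\<phi> i a) / real m" by (simp add: sum_nonneg)
    have fA: "finite (A i)" using A(1)[OF i] finite_subset by blast
    have "(\<Sum>a<m. ?\<phi> i a) = (\<Sum>a\<in>A i. ?\<phi> i a) + (\<Sum>a\<in>{..<m} - A i. ?\<phi> i a)"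
      using A(1)[OF i] by (simp add: sum.subset_diff)
    also have "\<dots> = card (A i) * exp (1/4) + (real m - card (A i)) * exp (- 3/4)"
      using A(1)[OF i] fA card_mono[OF _ A(1)[OF i]] by (simp add: card_Diff_subset of_nat_diff)
    also have "\<dots> = real m * exp (- 3/4) + card (A i) * (exp (1/4) - exp (- 3/4))"
      by (simp add: algebra_simps)
    also have "\<dots> \<le> real m * exp (- 3/4) + real m / 2 * (exp (1/4) - exp (- 3/4))"
      using A(2)[OF i] by (intro add_mono mult_right_mono) auto
    also have "\<dots> = real m / 2 * (exp (1/4) + exp (- 3/4))"
      by (simp add: algebra_simps)
    also have "\<dots> \<le> real m / 2 * (19/10)"
    proof (intro mult_left_mono)
      have "exp (1/4 :: real) \<le> 1 + 1/4 + (1/4)\<^sup>2" by (rule exp_bound) auto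
      moreover have "exp (- 3/4 :: real) \<le> 1 / 2"
      proof -
        \<comment> \<open>Six steps of 1/8 make 3/4, and \<open>(9/8)^6\<close> just exceeds
          2.\<close>
        have "(1 + 1/8 :: real) ^ 6 \<le> exp (1/8) ^ 6" by (intro power_mono exp_ge_add_one_self) auto
        also have "\<dots> = exp (3/4)" by (simp flip: exp_of_nat_mult)
        finally have "2 \<le> exp (3/4 :: real)" by (simp add: eval_nat_numeral)
        then show ?thesis by (simp add: exp_minus field_simps)
      qed
      ultimately show "exp (1/4 :: real) + exp (- 3/4) \<le> 19/10"
        by (simp add: power2_eq_square)
    qed auto
    finally show "(\<Sum>a<m. ?\<phi> i a) / real m \<le> 19/20"
      using m_pos by (simp add: field_simps)
  qed
  finally show ?thesis by simp
qed

text \<open>The values outside the dense ones carry at most a quarter of the mass of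
  \<open>f\<close>, so at each \<open>i\<close> in \<open>I\<close> three quarters of it sit on at
  most half of the alphabet.\<close>

lemma few_dense_values:
  assumes "finite M" "I \<subseteq> M" "\<And>z. 0 \<le> f z" "\<And>z. f z \<le> 1"
    and few: "\<And>i. i \<in> I \<Longrightarrow> 2 * card {a\<in>{..<m}. Av M f x / 4 \<le> Av (M - {i}) f (x(i := a))} \<le> m"
  shows "Av M f x \<le> (19/20) ^ card I"
proof (rule concentrated_mass_le[where A = "\<lambda>i. {a\<in>{..<m}. Av M f x / 4 \<le> Av (M - {i}) f (x(i := a))}"])
  fix i assume i: "i \<in> I"
  let ?A = "{a\<in>{..<m}. Av M f x / 4 \<le> Av (M - {i}) f (x(i := a))}"
  have fM: "0 \<le> Av M f x" using assms by (intro noise_ge_const) auto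
  have iM: "i \<in> M" using i assms by auto
  have "Av M f x = Av M (\<lambda>z. of_bool (z i \<in> ?A) * f z + of_bool (z i \<notin> ?A) * f z) x"
    by (rule arg_cong[of _ _ "\<lambda>h. Av M h x"]) (auto simp: fun_eq_iff)
  then have split: "Av M f x = Av M (\<lambda>z. of_bool (z i \<in> ?A) * f z) x + Av M (\<lambda>z. of_bool (z i \<notin> ?A) * f z) x"
    using assms(1) by (simp only: noise_add)
  have "Av M (\<lambda>z. of_bool (z i \<notin> ?A) * f z) x
      = (\<Sum>a<m. of_bool (a \<notin> ?A) * Av (M - {i}) f (x(i := a))) / real m"
    by (rule Av_coordinate[OF assms(1) iM])
  also have "\<dots> \<le> (\<Sum>a<m. Av M f x / 4) / real m"
    using fM by (intro divide_right_mono sum_mono) auto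
  also have "\<dots> = Av M f x / 4" using m_pos by simp
  finally show "3/4 * Av M f x \<le> Av M (\<lambda>z. of_bool (z i \<in> ?A) * f z) x"
    using split by linarith
qed (use assms in auto)

text \<open>Each function has fewer than \<open>l\<close> coordinates with at most
  \<open>m/2\<close> dense values. Some coordinate among \<open>2 * l\<close> is bad for neither,
  and there two sets of more than half of the alphabet must meet.\<close>

lemma common_dense_value:
  assumes "finite M" "2 * l \<le> card M"
    and f: "\<And>z. 0 \<le> f z" "\<And>z. f z \<le> 1" "(19/20) ^ l < Av M f x"
    and g: "\<And>z. 0 \<le> g z" "\<And>z. g z \<le> 1" "(19/20) ^ l < Av M g x"
  shows "\<exists>i\<in>M. \<exists>a<m. Av M f x / 4 \<le> Av (M - {i}) f (x(i := a)) \<and> Av M g x / 4 \<le> Av (M - {i}) g (x(i := a))"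
proof (rule ccontr)
  assume neg: "\<not> ?thesis"
  let ?D = "\<lambda>h i. {a\<in>{..<m}. Av M h x / 4 \<le> Av (M - {i}) h (x(i := a))}"
  let ?I = "\<lambda>h. {i\<in>M. 2 * card (?D h i) \<le> m}"
  have small: "card (?I h) < l"
    if h: "\<And>z. 0 \<le> h z" "\<And>z. h z \<le> 1" "(19/20) ^ l < Av M h x" for h
  proof (rule ccontr)
    assume "\<not> card (?I h) < l"
    then have "(19/20 :: real) ^ card (?I h) \<le> (19/20) ^ l"
      by (intro power_decreasing) auto
    moreover have "Av M h x \<le> (19/20) ^ card (?I h)"
      by (rule few_dense_values) (use assms h in auto)
    ultimately show False using h(3) by linarith
  qed
  have "M \<subseteq> ?I f \<union> ?I g"
  proof
    fix i assume i: "i \<in> M"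
    have "?D f i \<inter> ?D g i = {}" using neg i by auto
    then have "card (?D f i) + card (?D g i) = card (?D f i \<union> ?D g i)"
      by (simp add: card_Un_disjoint)
    also have "\<dots> \<le> card {..<m}" by (intro card_mono) auto
    finally show "i \<in> ?I f \<union> ?I g" using i by auto
  qed
  then have "card M \<le> card (?I f \<union> ?I g)" using assms(1) by (intro card_mono) auto
  also have "\<dots> \<le> card (?I f) + card (?I g)" by (rule card_Un_le)
  also have "\<dots> < 2 * l" using small[OF f] small[OF g] by simp
  finally show False using assms(2) by simp
qed

text \<open>Each fixed coordinate costs both functions a factor of at most 4; the factor
  \<open>4 ^ d\<close> in the hypotheses keeps the densities above the threshold of
  \<open>common_dense_value\<close> throughout.\<close>

lemma common_dense_values:
  assumes "finite M" "2 * l + d \<le> card M"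
    and f: "\<And>z. 0 \<le> f z" "\<And>z. f z \<le> 1" "(19/20) ^ l * 4 ^ d < Av M f x"
    and g: "\<And>z. 0 \<le> g z" "\<And>z. g z \<le> 1" "(19/20) ^ l * 4 ^ d < Av M g x"
  shows "\<exists>T z. T \<subseteq> M \<and> card T = d \<and> (\<forall>i. i \<notin> T \<longrightarrow> z i = x i)
    \<and> Av M f x / 4 ^ d \<le> Av (M - T) f z \<and> Av M g x / 4 ^ d \<le> Av (M - T) g z"
  using assms
proof (induction d arbitrary: M x)
  case 0
  then show ?case by (intro exI[of _ "{}"] exI[of _ x]) auto
next
  case (Suc d)
  have "(19/20) ^ l * 1 \<le> (19/20 :: real) ^ l * 4 ^ Suc d"
    by (intro mult_left_mono one_le_power) auto
  then have "(19/20) ^ l < Av M f x" "(19/20) ^ l < Av M g x"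
    using Suc.prems(5,8) by linarith+
  then obtain i a where ia: "i \<in> M" "a < m" "Av M f x / 4 \<le> Av (M - {i}) f (x(i := a))"
      "Av M g x / 4 \<le> Av (M - {i}) g (x(i := a))"
    using common_dense_value[of M l f x g] Suc.prems by auto
  have "\<exists>T z. T \<subseteq> M - {i} \<and> card T = d \<and> (\<forall>j. j \<notin> T \<longrightarrow> z j = (x(i := a)) j)
    \<and> Av (M - {i}) f (x(i := a)) / 4 ^ d \<le> Av (M - {i} - T) f z
    \<and> Av (M - {i}) g (x(i := a)) / 4 ^ d \<le> Av (M - {i} - T) g z"
  proof (rule Suc.IH[of "M - {i}" "x(i := a)"])
    show "(19/20) ^ l * 4 ^ d < Av (M - {i}) f (x(i := a))" using Suc.prems(5) ia(3) by simp
    show "(19/20) ^ l * 4 ^ d < Av (M - {i}) g (x(i := a))" using Suc.prems(8) ia(4) by simp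
  qed (use Suc.prems ia in auto)
  then obtain T z where T: "T \<subseteq> M - {i}" "card T = d" "\<forall>j. j \<notin> T \<longrightarrow> z j = (x(i := a)) j"
    "Av (M - {i}) f (x(i := a)) / 4 ^ d \<le> Av (M - {i} - T) f z"
    "Av (M - {i}) g (x(i := a)) / 4 ^ d \<le> Av (M - {i} - T) g z" by blast
  have *: "M - insert i T = M - {i} - T" by auto
  have fin: "finite T" using T(1) Suc.prems(1) finite_subset by blast
  have le: "p / 4 ^ Suc d \<le> r" if "p / 4 \<le> q" "q / 4 ^ d \<le> r" for p q r :: real
  proof -
    have "p / 4 / 4 ^ d \<le> q / 4 ^ d" using that by (intro divide_right_mono) auto
    then show ?thesis using that by simp
  qed
  show ?case
  proof (intro exI[of _ "insert i T"] exI[of _ z] conjI)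
    show "card (insert i T) = Suc d" using T fin by (subst card_insert_disjoint) auto
    show "Av M f x / 4 ^ Suc d \<le> Av (M - insert i T) f z" unfolding * using ia(3) T(4) by (rule le)
    show "Av M g x / 4 ^ Suc d \<le> Av (M - insert i T) g z" unfolding * using ia(4) T(5) by (rule le)
  qed (use T ia in auto)
qed

text \<open>Choose \<open>S\<close> of maximal size.\<close>
lemma global_restriction:
  assumes "finite N" "1 \<le> K" "0 < \<mu>" "\<mu> \<le> Av N h x"
  shows "\<exists>S z. S \<subseteq> N \<and> (\<forall>i. i \<notin> S \<longrightarrow> z i = x i) \<and> K ^ card S * \<mu> \<le> Av (N - S) h z \<and>
    (\<forall>U y. U \<subseteq> N - S \<longrightarrow> (\<forall>i. i \<notin> U \<longrightarrow> y i = z i) \<longrightarrow>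
       Av (N - S - U) h y \<le> K ^ card U * Av (N - S) h z)"
proof -
  let ?P = "\<lambda>s. \<exists>S z. S \<subseteq> N \<and> card S = s \<and> (\<forall>i. i \<notin> S \<longrightarrow> z i = x i) \<and> K ^ s * \<mu> \<le> Av (N - S) h z"
  have "?P 0" using assms by (intro exI[of _ "{}"] exI[of _ x]) auto
  moreover have "s \<le> card N" if "?P s" for s
    using that assms(1) card_mono by blast
  ultimately obtain s where s: "?P s" "\<And>s'. ?P s' \<Longrightarrow> s' \<le> s"
    using GreatestI_nat[of ?P 0 "card N"] Greatest_le_nat[of ?P _ "card N"] by blast
  obtain S z where S: "S \<subseteq> N" "card S = s" "\<forall>i. i \<notin> S \<longrightarrow> z i = x i" "K ^ s * \<mu> \<le> Av (N - S) h z"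
    using s(1) by blast
  have "Av (N - S - U) h y \<le> K ^ card U * Av (N - S) h z"
    if U: "U \<subseteq> N - S" "\<forall>i. i \<notin> U \<longrightarrow> y i = z i" for U y
  proof (cases "U = {}")
    case True
    then have "y = z" using U by auto
    then show ?thesis using True by simp
  next
    case False
    have fin: "finite S" "finite U" using S(1) U(1) assms(1) finite_subset[of S N] finite_subset[of U "N - S"] by auto
    then have card: "card (S \<union> U) = s + card U"
      using U(1) S(2) by (subst card_Un_disjoint) auto
    have "0 < card U" using False fin by (simp add: card_gt_0_iff)
    then have "\<not> ?P (s + card U)" using s(2)[of "s + card U"] by auto
    moreover have "S \<union> U \<subseteq> N" "\<forall>i. i \<notin> S \<union> U \<longrightarrow> y i = x i" using U S by auto
    ultimately have "\<not> K ^ (s + card U) * \<mu> \<le> Av (N - (S \<union> U)) h y"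
      using card by blast
    moreover have "N - (S \<union> U) = N - S - U" by auto
    ultimately have "Av (N - S - U) h y \<le> K ^ card U * (K ^ s * \<mu>)"
      by (simp add: power_add mult_ac)
    also have "\<dots> \<le> K ^ card U * Av (N - S) h z"
      using S(4) assms(2) by (intro mult_left_mono) auto
    finally show ?thesis .
  qed
  with S show ?thesis by (intro exI[of _ S] exI[of _ z]) auto
qed

text \<open>The complement of a union of dictators. It serves both to express uncapturability and to
  forbid agreements with an assignment \<open>q\<close> that the other family has fixed.\<close>

definition off :: "nat set \<Rightarrow> (nat \<Rightarrow> nat) \<Rightarrow> (nat \<Rightarrow> nat) \<Rightarrow> real" where
  "off Q q z = of_bool (\<forall>i\<in>Q. z i \<noteq> q i)"

lemma off_range: "0 \<le> off Q q z" "off Q q z \<le> 1"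
  by (auto simp: off_def)

text \<open>A union bound: the part of \<open>h\<close> on a dictator \<open>z i = q i\<close> has
  mean at most \<open>1/m\<close> times the mean of the corresponding restriction.\<close>

lemma Av_off_ge:
  assumes "finite M" "Q \<subseteq> M" "\<And>z. 0 \<le> h z"
  shows "Av M h x - (\<Sum>i\<in>Q. Av (M - {i}) h (x(i := q i))) / real m \<le> Av M (\<lambda>z. h z * off Q q z) x"
proof -
  have Q: "finite Q" using assms finite_subset by blast
  have "Av M (\<lambda>z. h z - (\<Sum>i\<in>Q. of_bool (z i = q i) * h z)) x \<le> Av M (\<lambda>z. h z * off Q q z) x"
  proof (rule noise_mono)
    fix z
    show "h z - (\<Sum>i\<in>Q. of_bool (z i = q i) * h z) \<le> h z * off Q q z"
    proof (cases "\<forall>i\<in>Q. z i \<noteq> q i")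
      case True
      then show ?thesis using assms(3) by (simp add: off_def)
    next
      case False
      then obtain i where i: "i \<in> Q" "z i = q i" by auto
      then have "of_bool (z i = q i) * h z \<le> (\<Sum>i\<in>Q. of_bool (z i = q i) * h z)"
        using Q assms(3) by (intro member_le_sum) auto
      then show ?thesis using False i by (simp add: off_def)
    qed
  qed (use assms in auto)
  moreover have "Av M (\<lambda>z. h z - (\<Sum>i\<in>Q. of_bool (z i = q i) * h z)) x
      = Av M h x - (\<Sum>i\<in>Q. Av M (\<lambda>z. of_bool (z i = q i) * h z) x)"
    unfolding noise_diff[OF assms(1)] noise_sum[OF Q assms(1)] ..
  moreover have "(\<Sum>i\<in>Q. Av M (\<lambda>z. of_bool (z i = q i) * h z) x)
      \<le> (\<Sum>i\<in>Q. Av (M - {i}) h (x(i := q i)) / real m)"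
  proof (rule sum_mono)
    fix i assume "i \<in> Q"
    then have iM: "i \<in> M" using assms by auto
    have nn: "0 \<le> Av (M - {i}) h y" for y using assms by (intro noise_ge_const) auto
    have "(\<Sum>a<m. of_bool (a = q i) * Av (M - {i}) h (x(i := a))) \<le> Av (M - {i}) h (x(i := q i))"
    proof (cases "q i < m")
      case True
      then have "(\<Sum>a<m. of_bool (a = q i) * Av (M - {i}) h (x(i := a)))
          = (\<Sum>a\<in>{q i}. of_bool (a = q i) * Av (M - {i}) h (x(i := a)))"
        by (intro sum.mono_neutral_right) auto
      then show ?thesis by simp
    next
      case False
      then have "(\<Sum>a<m. of_bool (a = q i) * Av (M - {i}) h (x(i := a))) = 0"
        by (intro sum.neutral) auto
      then show ?thesis using nn by simp
    qed
    then show "Av M (\<lambda>z. of_bool (z i = q i) * h z) x \<le> Av (M - {i}) h (x(i := q i)) / real m"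
      using Av_coordinate[OF assms(1) iM, of "\<lambda>a. of_bool (a = q i)" h x]
      by (simp add: divide_right_mono)
  qed
  ultimately show ?thesis by (simp add: sum_divide_distrib)
qed

section \<open>Uncapturable subcubes\<close>

lemma Av_eq_sum:
  assumes "finite N"
  shows "Av N f x = (\<Sum>y\<in>PiE N (\<lambda>_. {..<m}). f (override_on x y N)) / real m ^ card N"
  using assms
proof (induction N arbitrary: x rule: finite_induct)
  case (insert i N)
  let ?P = "PiE N (\<lambda>_. {..<m})"
  have ov: "override_on x (y(i := a)) (insert i N) = override_on (x(i := a)) y N" for a y
    using insert.hyps by (auto simp: override_on_def fun_eq_iff)
  have "(\<Sum>y\<in>PiE (insert i N) (\<lambda>_. {..<m}). f (override_on x y (insert i N)))
      = (\<Sum>(a, y)\<in>{..<m} \<times> ?P. f (override_on x (y(i := a)) (insert i N)))"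
    unfolding PiE_insert_eq using inj_combinator[OF insert.hyps(2), of "\<lambda>_. {..<m}"]
    by (subst sum.reindex) (auto simp: case_prod_unfold)
  also have "\<dots> = (\<Sum>a<m. \<Sum>y\<in>?P. f (override_on (x(i := a)) y N))"
    by (simp add: ov sum.cartesian_product)
  finally show ?case
    using insert by (simp add: Av_insert avg_def mult.commute del: fun_upd_apply flip: sum_divide_distrib)
qed (simp add: override_on_def)

text \<open>Points of the cube are \<open>undefined\<close> outside \<open>{..<n}\<close>, whereas
  the operators evaluate at arbitrary functions; restricting first reconciles the two.\<close>

definition ind :: "nat \<Rightarrow> (nat \<Rightarrow> nat) set \<Rightarrow> (nat \<Rightarrow> nat) \<Rightarrow> real" where
  "ind n A z = of_bool (restrict z {..<n} \<in> A)"

lemma ind_range: "0 \<le> ind n A z" "ind n A z \<le> 1"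
  by (auto simp: ind_def)

lemma ind_off_pos_iff:
  "0 < ind n A z * off Q q z \<longleftrightarrow> restrict z {..<n} \<in> A \<and> (\<forall>i\<in>Q. z i \<noteq> q i)"
  by (simp add: ind_def off_def)

lemma dep_ind: "dep {..<n} (ind n A)"
proof -
  have "restrict x {..<n} = restrict y {..<n}" if "\<forall>i\<in>{..<n}. x i = y i" for x y :: "nat \<Rightarrow> nat"
    using that by (intro restrict_ext) auto
  then show ?thesis unfolding dep_def ind_def by metis
qed

lemma mu_eq_Av: "mu m n A = Av {..<n} (ind n A) x"
proof -
  have "ind n A (override_on x y {..<n}) = of_bool (y \<in> A)" if "y \<in> cube m n" for y
  proof -
    have "restrict (override_on x y {..<n}) {..<n} = y"
      using that by (auto simp: cube_def override_on_def fun_eq_iff PiE_def extensional_def)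
    then show ?thesis by (simp add: ind_def)
  qed
  then have "(\<Sum>y\<in>cube m n. ind n A (override_on x y {..<n})) = (\<Sum>y\<in>cube m n. of_bool (y \<in> A))"
    by (intro sum.cong) auto
  also have "\<dots> = real (card (A \<inter> cube m n))"
    by (simp add: cube_def finite_PiE Int_commute Collect_mem_eq)
  finally show ?thesis by (simp add: Av_eq_sum mu_def cube_def)
qed

lemma Av_subcube:
  assumes "finite N" "R \<subseteq> N" "\<And>i. i \<in> R \<Longrightarrow> \<alpha> i < m"
  shows "Av N (\<lambda>z. of_bool (\<forall>i\<in>R. z i = \<alpha> i) * f z) x
    = Av (N - R) f (override_on x \<alpha> R) / real m ^ card R"
proof -
  have "finite R" using assms finite_subset by blast
  then show ?thesis using assms
  proof (induction R arbitrary: N x rule: finite_induct)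
    case (insert i R)
    have iN: "i \<in> N" using insert by auto
    let ?g = "\<lambda>z. of_bool (\<forall>j\<in>R. z j = \<alpha> j) * f z"
    have "Av N (\<lambda>z. of_bool (\<forall>j\<in>insert i R. z j = \<alpha> j) * f z) x
        = Av N (\<lambda>z. of_bool (z i = \<alpha> i) * ?g z) x"
      by (rule arg_cong[of _ _ "\<lambda>h. Av N h x"]) (auto simp: fun_eq_iff)
    also have "\<dots> = (\<Sum>a<m. of_bool (a = \<alpha> i) * Av (N - {i}) ?g (x(i := a))) / real m"
      by (rule Av_coordinate[OF insert.prems(1) iN])
    also have "(\<Sum>a<m. of_bool (a = \<alpha> i) * Av (N - {i}) ?g (x(i := a)))
        = (\<Sum>a\<in>{\<alpha> i}. of_bool (a = \<alpha> i) * Av (N - {i}) ?g (x(i := a)))"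
      using insert.prems(3)[of i] by (intro sum.mono_neutral_right) auto
    also have "\<dots> = Av (N - {i}) ?g (x(i := \<alpha> i))" by simp
    also have "\<dots> = Av (N - {i} - R) f (override_on (x(i := \<alpha> i)) \<alpha> R) / real m ^ card R"
      using insert.prems insert.hyps by (intro insert.IH) auto
    also have "override_on (x(i := \<alpha> i)) \<alpha> R = override_on x \<alpha> (insert i R)"
      by (auto simp: override_on_def fun_eq_iff)
    also have "N - {i} - R = N - insert i R" by auto
    finally show ?case using insert.hyps by (simp add: mult.commute)
  qed (simp add: override_on_def)
qed

lemma mu_mono: "A \<subseteq> B \<Longrightarrow> mu m n A \<le> mu m n B"
  unfolding mu_def
  by (intro divide_right_mono) (auto intro!: card_mono simp: cube_def finite_PiE)

lemma mu_Un_le: "mu m n (A \<union> B) \<le> mu m n A + mu m n B"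
  unfolding mu_def add_divide_distrib[symmetric] Int_Un_distrib2
  by (intro divide_right_mono) (auto simp flip: of_nat_add intro: card_Un_le)

lemma mu_UN_le:
  assumes "finite Q"
  shows "mu m n (\<Union>i\<in>Q. A i) \<le> (\<Sum>i\<in>Q. mu m n (A i))"
  using assms
proof (induction Q rule: finite_induct)
  case empty
  then show ?case by (simp add: mu_def)
next
  case (insert i Q)
  have "mu m n (A i \<union> (\<Union>i\<in>Q. A i)) \<le> mu m n (A i) + mu m n (\<Union>i\<in>Q. A i)" by (rule mu_Un_le)
  then show ?case using insert by simp
qed

lemma subcube_less: "is_subcube m n (R, \<alpha>) \<Longrightarrow> i \<in> R \<Longrightarrow> \<alpha> i < m"
  by (auto simp: is_subcube_def)

lemma subcube_subset: "is_subcube m n (R, \<alpha>) \<Longrightarrow> R \<subseteq> {..<n}"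
  by (simp add: is_subcube_def)

lemma mu_subcube_off:
  assumes "is_subcube m n (R, \<alpha>)" "Q \<subseteq> {..<n}" "F \<subseteq> cube m n"
  shows "mu m n {x \<in> F \<inter> subcube m n R \<alpha>. \<forall>i\<in>Q. x i \<noteq> q i}
    = Av ({..<n} - R) (\<lambda>z. ind n F z * off Q q z) \<alpha> / real m ^ card R"
proof -
  have R: "R \<subseteq> {..<n}" by (rule subcube_subset[OF assms(1)])
  have "ind n {x \<in> F \<inter> subcube m n R \<alpha>. \<forall>i\<in>Q. x i \<noteq> q i}
      = (\<lambda>z. of_bool (\<forall>i\<in>R. z i = \<alpha> i) * (ind n F z * off Q q z))"
    using assms(2,3) R by (auto simp: fun_eq_iff ind_def off_def subcube_def subset_iff)
  moreover have "override_on \<alpha> \<alpha> R = \<alpha>" by (simp add: override_on_def)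
  ultimately show ?thesis
    using Av_subcube[OF _ R, of \<alpha> "\<lambda>z. ind n F z * off Q q z" \<alpha>] subcube_less[OF assms(1)]
    by (simp add: mu_eq_Av[of n _ \<alpha>])
qed

lemma mu_subcube_le:
  assumes "is_subcube m n (R, \<alpha>)" "F \<subseteq> cube m n"
  shows "mu m n (F \<inter> subcube m n R \<alpha>) \<le> 1 / real m ^ card R"
proof -
  have "mu m n (F \<inter> subcube m n R \<alpha>) = Av ({..<n} - R) (\<lambda>z. ind n F z * off {} \<alpha> z) \<alpha> / real m ^ card R"
    using mu_subcube_off[OF assms(1) _ assms(2), of "{}" \<alpha>] by (simp add: Int_def)
  also have "\<dots> \<le> 1 / real m ^ card R"
    by (intro divide_right_mono noise_le_const) (auto simp: off_def ind_range)
  finally show ?thesis .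
qed

text \<open>No \<open>r\<close> dictators capture \<open>F\<close> inside the subcube up to measure
  \<open>m^(-k)\<close>. The threshold refers to the whole cube rather than to the subcube, so that
  branching can stop at co-dimension \<open>k\<close>, where a subcube itself has only that measure.
  The values \<open>q i\<close> are below \<open>m\<close> because a failure supplies the subcubes
  to branch into.\<close>

definition uncapturable :: "nat \<Rightarrow> nat \<Rightarrow> nat \<Rightarrow> (nat \<Rightarrow> nat) set \<Rightarrow> nat set \<times> (nat \<Rightarrow> nat) \<Rightarrow> bool" where
  "uncapturable n k r F D \<longleftrightarrow> (\<forall>Q q. Q \<subseteq> {..<n} - fst D \<longrightarrow> card Q \<le> r \<longrightarrow> (\<forall>i\<in>Q. q i < m) \<longrightarrow>
     1 / real m ^ k < mu m n {x \<in> F \<inter> subcube m n (fst D) (snd D). \<forall>i\<in>Q. x i \<noteq> q i})"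

lemma uncapturable_Av:
  assumes "uncapturable n k r F (R, \<alpha>)" "is_subcube m n (R, \<alpha>)" "F \<subseteq> cube m n"
    and Q: "Q \<subseteq> {..<n} - R" "card Q \<le> r" "\<And>i. i \<in> Q \<Longrightarrow> q i < m"
  shows "1 / real m ^ k \<le> Av ({..<n} - R) (\<lambda>z. ind n F z * off Q q z) \<alpha>"
proof -
  have nn: "0 \<le> Av ({..<n} - R) (\<lambda>z. ind n F z * off Q q z) \<alpha>"
    by (intro noise_ge_const) (auto simp: ind_range off_range)
  have "1 / real m ^ k < mu m n {x \<in> F \<inter> subcube m n R \<alpha>. \<forall>i\<in>Q. x i \<noteq> q i}"
    using assms(1) Q by (auto simp: uncapturable_def)
  also have "\<dots> = Av ({..<n} - R) (\<lambda>z. ind n F z * off Q q z) \<alpha> / real m ^ card R"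
    using assms Q by (intro mu_subcube_off) auto
  also have "\<dots> \<le> Av ({..<n} - R) (\<lambda>z. ind n F z * off Q q z) \<alpha> / 1"
    using nn m_pos by (intro divide_left_mono) (auto simp: one_le_power)
  finally show ?thesis by simp
qed

text \<open>A branching tree: at a capturable subcube the at most \<open>r\<close> capturing
  dictators are the children, each of co-dimension one more, and the uncaptured remainder is
  discarded at cost \<open>m^(-k)\<close>, as is everything that reaches co-dimension
  \<open>k\<close>. One remainder plus \<open>r\<close> children gives the recursion
  \<open>1 + r (r + 1)^j \<le> (r + 1)^(j + 1)\<close>, which bounds the discarded pieces and the
  subcubes alike.\<close>

lemma uncapturable_cover:
  assumes "F \<subseteq> cube m n" "is_subcube m n (R, \<alpha>)" "card R + j = k"
  shows "\<exists>\<D>. finite \<D> \<and> card \<D> \<le> (r + 1) ^ j \<and>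
    (\<forall>D\<in>\<D>. is_subcube m n D \<and> card (fst D) \<le> k \<and> uncapturable n k r F D) \<and>
    mu m n (F \<inter> subcube m n R \<alpha> - union_cubes m n \<D>) \<le> real ((r + 1) ^ j) / real m ^ k"
  using assms(2,3)
proof (induction j arbitrary: R \<alpha>)
  case 0
  then show ?case using mu_subcube_le[OF 0(1) assms(1)]
    by (intro exI[of _ "{}"]) (auto simp: union_cubes_def)
next
  case (Suc j)
  show ?case
  proof (cases "uncapturable n k r F (R, \<alpha>)")
    case True
    have empty: "F \<inter> subcube m n R \<alpha> - union_cubes m n {(R, \<alpha>)} = {}"
      by (auto simp: union_cubes_def)
    have "mu m n (F \<inter> subcube m n R \<alpha> - union_cubes m n {(R, \<alpha>)}) = 0"
      unfolding empty by (simp add: mu_def)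
    moreover have "1 \<le> (r + 1) ^ Suc j" by (rule one_le_power) simp
    ultimately show ?thesis
      using Suc.prems True by (intro exI[of _ "{(R, \<alpha>)}"]) (simp del: power_Suc)
  next
    case False
    then obtain Q q where Q: "Q \<subseteq> {..<n} - R" "card Q \<le> r" "\<forall>i\<in>Q. q i < m"
      "mu m n {x \<in> F \<inter> subcube m n R \<alpha>. \<forall>i\<in>Q. x i \<noteq> q i} \<le> 1 / real m ^ k"
      by (auto simp: uncapturable_def not_less)
    have finQ: "finite Q" using Q(1) finite_subset by blast
    have finR: "finite R" using subcube_subset[OF Suc.prems(1)] finite_subset by blast
    let ?D = "\<lambda>i \<D>. finite \<D> \<and> card \<D> \<le> (r + 1) ^ j \<and>
      (\<forall>D\<in>\<D>. is_subcube m n D \<and> card (fst D) \<le> k \<and> uncapturable n k r F D) \<and>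
      mu m n (F \<inter> subcube m n (insert i R) (\<alpha>(i := q i)) - union_cubes m n \<D>)
        \<le> real ((r + 1) ^ j) / real m ^ k"
    have "\<exists>\<D>. ?D i \<D>" if i: "i \<in> Q" for i
    proof (rule Suc.IH)
      show "is_subcube m n (insert i R, \<alpha>(i := q i))"
        using Suc.prems(1) i Q by (auto simp: is_subcube_def PiE_def extensional_def)
      show "card (insert i R) + j = k"
        using i Q(1) finR Suc.prems(2) by (subst card_insert_disjoint) auto
    qed
    then obtain \<D> where \<D>: "\<And>i. i \<in> Q \<Longrightarrow> ?D i (\<D> i)" by metis
    let ?U = "\<Union>i\<in>Q. \<D> i"
    have "F \<inter> subcube m n R \<alpha> - union_cubes m n ?U
        \<subseteq> {x \<in> F \<inter> subcube m n R \<alpha>. \<forall>i\<in>Q. x i \<noteq> q i}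
          \<union> (\<Union>i\<in>Q. F \<inter> subcube m n (insert i R) (\<alpha>(i := q i)) - union_cubes m n (\<D> i))"
      using Q(1) by (auto simp: subcube_def union_cubes_def subset_iff)
    then have "mu m n (F \<inter> subcube m n R \<alpha> - union_cubes m n ?U)
        \<le> mu m n ({x \<in> F \<inter> subcube m n R \<alpha>. \<forall>i\<in>Q. x i \<noteq> q i}
          \<union> (\<Union>i\<in>Q. F \<inter> subcube m n (insert i R) (\<alpha>(i := q i)) - union_cubes m n (\<D> i)))"
      by (rule mu_mono)
    also have "\<dots> \<le> mu m n {x \<in> F \<inter> subcube m n R \<alpha>. \<forall>i\<in>Q. x i \<noteq> q i}
        + mu m n (\<Union>i\<in>Q. F \<inter> subcube m n (insert i R) (\<alpha>(i := q i)) - union_cubes m n (\<D> i))"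
      by (rule mu_Un_le)
    also have "\<dots> \<le> 1 / real m ^ k + (\<Sum>i\<in>Q. real ((r + 1) ^ j) / real m ^ k)"
      using Q(4) \<D> finQ by (intro add_mono order_trans[OF mu_UN_le] sum_mono) auto
    also have "\<dots> = real (1 + card Q * (r + 1) ^ j) / real m ^ k"
      by (simp add: add_divide_distrib)
    also have le: "1 + card Q * (r + 1) ^ j \<le> (r + 1) ^ Suc j"
    proof -
      have "1 + card Q * (r + 1) ^ j \<le> (r + 1) ^ j + r * (r + 1) ^ j"
        using Q(2) by (intro add_mono mult_right_mono) auto
      then show ?thesis by simp
    qed
    then have "real (1 + card Q * (r + 1) ^ j) / real m ^ k \<le> real ((r + 1) ^ Suc j) / real m ^ k"
      by (intro divide_right_mono of_nat_mono) auto
    finally have res: "mu m n (F \<inter> subcube m n R \<alpha> - union_cubes m n ?U)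
        \<le> real ((r + 1) ^ Suc j) / real m ^ k" .
    have "card ?U \<le> (\<Sum>i\<in>Q. card (\<D> i))" using finQ by (rule card_UN_le)
    also have "\<dots> \<le> (\<Sum>i\<in>Q. (r + 1) ^ j)" using \<D> by (intro sum_mono) auto
    finally have "card ?U \<le> card Q * (r + 1) ^ j" by simp
    with le have "card ?U \<le> (r + 1) ^ Suc j" by linarith
    moreover have "finite ?U" using finQ \<D> by blast
    moreover have "\<forall>D\<in>?U. is_subcube m n D \<and> card (fst D) \<le> k \<and> uncapturable n k r F D"
      using \<D> by blast
    ultimately show ?thesis using res by blast
  qed
qed

section \<open>Building a forbidden pair from two subcubes\<close>

lemma dep_mult_off:
  assumes "dep N h" "Q \<subseteq> N"
  shows "dep N (\<lambda>z. h z * off Q q z)"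
  unfolding dep_def
proof (intro allI impI)
  fix x y :: "nat \<Rightarrow> nat" assume xy: "\<forall>i\<in>N. x i = y i"
  then have "h x = h y" using assms(1) by (auto simp: dep_def)
  moreover have "off Q q x = off Q q y" using xy assms(2) by (auto simp: off_def subset_iff)
  ultimately show "h x * off Q q x = h y * off Q q y" by simp
qed

text \<open>Brings the two families to the common coordinate set \<open>M\<close>. The coordinates
  that only the other family has fixed are averaged out, counting only points that differ there from
  the other family's values \<open>\<beta>\<close>. By globalness each such dictator removes at most
  \<open>K * p / m\<close>, so at most \<open>r\<close> of them remove no more than half of the
  density; the last claim recovers an actual point from a positive value of
  \<open>f\<close>.\<close>

lemma global_average:
  fixes h :: "(nat \<Rightarrow> nat) \<Rightarrow> real" and \<beta> :: "nat \<Rightarrow> nat"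
  assumes fin: "finite N" and h: "\<And>z. 0 \<le> h z" "\<And>z. h z \<le> 1" "dep N h"
    and sub: "R1 \<subseteq> N" "R2 \<subseteq> N" and p: "p = Av (N - R1) h \<alpha>" "0 < p"
    and glob: "\<forall>U y. U \<subseteq> N - R1 \<longrightarrow> (\<forall>i. i \<notin> U \<longrightarrow> y i = \<alpha> i) \<longrightarrow>
      Av (N - R1 - U) h y \<le> K ^ card U * p"
    and r: "card (R2 - R1) \<le> r" "2 * real r * K \<le> real m" "0 \<le> K"
    and f_def: "f = (\<lambda>x. Av (R2 - R1) (\<lambda>z. h z * off (R2 - R1) \<beta> z) (override_on x \<alpha> R1))"
    and M_def: "M = N - (R1 \<union> R2)"
  shows "0 \<le> f x" "f x \<le> 1" "dep M f" "p / 2 \<le> Av M f x"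
    and "U \<subseteq> M \<Longrightarrow> Av (M - U) f x \<le> K ^ card U * p"
    and "0 < f x \<Longrightarrow> \<exists>z. 0 < h z \<and> (\<forall>i\<in>R1. z i = \<alpha> i) \<and> (\<forall>i\<in>M. z i = x i) \<and> (\<forall>i\<in>R2 - R1. z i \<noteq> \<beta> i)"
proof -
  let ?Q = "R2 - R1"
  let ?h = "\<lambda>z. h z * off ?Q \<beta> z"
  have finR: "finite R1" "finite R2" using sub fin finite_subset by auto
  have hr: "0 \<le> ?h z" "?h z \<le> h z" "?h z \<le> 1" for z
    using h(1,2)[of z] off_range[of ?Q \<beta> z] by (auto intro: mult_left_le mult_le_one)
  have dh: "dep N ?h" using h(3) sub by (intro dep_mult_off) auto
  show "0 \<le> f x" "f x \<le> 1"
    unfolding f_def using finR hr by (auto intro!: noise_ge_const noise_le_const)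
  show "dep M f"
    unfolding dep_def f_def
  proof (intro allI impI)
    fix x y :: "nat \<Rightarrow> nat" assume xy: "\<forall>i\<in>M. x i = y i"
    show "Av ?Q ?h (override_on x \<alpha> R1) = Av ?Q ?h (override_on y \<alpha> R1)"
    proof (rule Av_cong_dep[OF _ dh])
      fix i assume "i \<in> N" "i \<notin> ?Q"
      then have "i \<in> R1 \<or> i \<in> M" by (auto simp: M_def)
      then show "override_on x \<alpha> R1 i = override_on y \<alpha> R1 i"
        using xy by (auto simp: override_on_def)
    qed (use finR in auto)
  qed
  have AvM: "Av (M - U) f x = Av (N - R1 - U) ?h (override_on x \<alpha> R1)" if U: "U \<subseteq> M" for U x
  proof -
    have "Av (M - U) f x = Av (M - U) (Av ?Q ?h) (override_on x \<alpha> R1)"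
      unfolding f_def using fin by (intro Av_override) (auto simp: M_def)
    also have "Av (M - U) (Av ?Q ?h) = Av ((M - U) \<union> ?Q) ?h"
      using fin finR by (subst noise_Un) (auto simp: M_def)
    also have "(M - U) \<union> ?Q = N - R1 - U" using U sub by (auto simp: M_def)
    finally show ?thesis .
  qed
  show "Av (M - U) f x \<le> K ^ card U * p" if U: "U \<subseteq> M"
  proof -
    have "Av (M - U) f x \<le> Av (N - R1 - U) h (override_on x \<alpha> R1)"
      unfolding AvM[OF U] using fin hr by (intro noise_mono) auto
    also have "\<dots> = Av (N - R1 - U) h (override_on \<alpha> x U)"
      by (rule Av_cong_dep[OF _ h(3)]) (use fin U in \<open>auto simp: override_on_def M_def\<close>)
    also have "\<dots> \<le> K ^ card U * p"
      using U by (intro glob[rule_format]) (auto simp: M_def override_on_def)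
    finally show ?thesis .
  qed
  show "p / 2 \<le> Av M f x"
  proof -
    have "Av M f x = Av (N - R1) ?h (override_on x \<alpha> R1)" using AvM[of "{}"] by simp
    also have "\<dots> = Av (N - R1) ?h \<alpha>"
      by (rule Av_cong_dep[OF _ dh]) (use fin in \<open>auto simp: override_on_def\<close>)
    finally have eq: "Av M f x = Av (N - R1) ?h \<alpha>" .
    have "(\<Sum>i\<in>?Q. Av (N - R1 - {i}) h (\<alpha>(i := \<beta> i))) \<le> (\<Sum>i\<in>?Q. K ^ 1 * p)"
    proof (rule sum_mono)
      fix i assume "i \<in> ?Q"
      then show "Av (N - R1 - {i}) h (\<alpha>(i := \<beta> i)) \<le> K ^ 1 * p"
        using glob[rule_format, of "{i}" "\<alpha>(i := \<beta> i)"] sub by auto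
    qed
    also have "\<dots> \<le> real r * (K * p)"
      using r p by (auto intro!: mult_right_mono)
    finally have "(\<Sum>i\<in>?Q. Av (N - R1 - {i}) h (\<alpha>(i := \<beta> i))) / real m \<le> real r * (K * p) / real m"
      by (rule divide_right_mono) simp
    also have "\<dots> \<le> p / 2"
    proof -
      have "(2 * real r * K) * p \<le> real m * p" using r p by (intro mult_right_mono) auto
      then show ?thesis using m_pos by (simp add: field_simps)
    qed
    finally have "(\<Sum>i\<in>?Q. Av (N - R1 - {i}) h (\<alpha>(i := \<beta> i))) / real m \<le> p / 2" .
    moreover have "Av (N - R1) h \<alpha> - (\<Sum>i\<in>?Q. Av (N - R1 - {i}) h (\<alpha>(i := \<beta> i))) / real m
        \<le> Av (N - R1) ?h \<alpha>"
      using fin sub h by (intro Av_off_ge) auto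
    ultimately show ?thesis using eq p by linarith
  qed
  show "\<exists>z. 0 < h z \<and> (\<forall>i\<in>R1. z i = \<alpha> i) \<and> (\<forall>i\<in>M. z i = x i) \<and> (\<forall>i\<in>?Q. z i \<noteq> \<beta> i)"
    if pos: "0 < f x"
  proof -
    obtain z where z: "\<forall>i. i \<notin> ?Q \<longrightarrow> z i = override_on x \<alpha> R1 i" "0 < ?h z"
      using Av_pos_witness[OF _ pos[unfolded f_def]] finR by auto
    have "0 < h z" "off ?Q \<beta> z \<noteq> 0"
      using z(2) h(1)[of z] off_range[of ?Q \<beta> z] by (auto simp: zero_less_mult_iff)
    then show ?thesis
      using z(1) by (intro exI[of _ z]) (auto simp: off_def override_on_def M_def)
  qed
qed


text \<open>Fixing \<open>T\<close> keeps a function global with a larger growth rate. Comparing the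
  new density with the old costs a constant \<open>2 * 4 ^ t * K ^ t\<close> once; for nonempty
  \<open>U\<close> this can be charged to one coordinate of \<open>U\<close>, and for empty
  \<open>U\<close> nothing is to be shown. The 2 stems from \<open>global_average\<close>, the
  \<open>4 ^ t\<close> from \<open>common_dense_values\<close>.\<close>

lemma global_fix:
  assumes "finite M" "T \<subseteq> M" "card T \<le> t" "dep M f" "1 \<le> K" "0 < p"
    and glob: "\<And>U x. U \<subseteq> M \<Longrightarrow> Av (M - U) f x \<le> K ^ card U * p"
    and \<mu>: "\<mu> = Av (M - T) f z" "p \<le> 2 * 4 ^ t * \<mu>"
    and U: "U \<subseteq> M - T"
  shows "Av (M - T - U) (\<lambda>x. f (override_on x z T)) x \<le> (2 * 4 ^ t * K ^ (t + 1)) ^ card U * \<mu>"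
proof -
  have eq: "Av (M - T - U) (\<lambda>x. f (override_on x z T)) x = Av (M - T - U) f (override_on x z T)"
    using assms by (intro Av_override) auto
  have fin: "finite T" "finite U" using assms finite_subset[of T M] finite_subset[of U "M - T"] by auto
  have "0 < 2 * 4 ^ t * \<mu>" using assms by linarith
  then have \<mu>0: "0 < \<mu>" by (simp add: zero_less_mult_iff)
  show ?thesis
  proof (cases "U = {}")
    case True
    have "Av (M - T) f (override_on x z T) = Av (M - T) f z"
      by (rule Av_cong_dep[OF _ assms(4)]) (use assms(1) in \<open>auto simp: override_on_def\<close>)
    then show ?thesis using True eq \<mu> by simp
  next
    case False
    let ?c = "2 * 4 ^ t :: real"
    have cU: "1 \<le> card U" using False fin by (simp add: Suc_le_eq card_gt_0_iff)
    have "M - T - U = M - (T \<union> U)" by auto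
    then have "Av (M - T - U) f (override_on x z T) \<le> K ^ card (T \<union> U) * p"
      using glob[of "T \<union> U"] assms(2) U by auto
    also have "card (T \<union> U) = card T + card U"
      using fin U by (subst card_Un_disjoint) auto
    also have "K ^ (card T + card U) * p \<le> K ^ (t + card U) * (?c * \<mu>)"
      using assms by (intro mult_mono power_increasing) auto
    also have "\<dots> = ?c ^ 1 * (K ^ t) ^ 1 * K ^ card U * \<mu>" by (simp add: power_add)
    also have "\<dots> \<le> ?c ^ card U * (K ^ t) ^ card U * K ^ card U * \<mu>"
    proof -
      have "(1 :: real) \<le> 4 ^ t" by (rule one_le_power) simp
      then have "1 \<le> ?c" by linarith
      then show ?thesis
        using assms cU \<mu>0 by (intro mult_right_mono mult_mono power_increasing one_le_power) auto
    qed
    also have "\<dots> = (?c * K ^ (t + 1)) ^ card U * \<mu>"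
      by (simp add: power_mult_distrib power_add mult_ac)
    finally show ?thesis using eq by simp
  qed
qed

text \<open>Exactly \<open>t - 1\<close> agreements are assembled: those already in
  \<open>R \<inter> R'\<close>, \<open>d\<close> further ones on a set \<open>T\<close>, and none
  elsewhere. The care lies in the order in which coordinates become fixed, as each family must avoid
  whatever values the other has been given.\<close>

lemma uncapturable_agree:
  fixes K :: real
  assumes F: "F \<subseteq> cube m n" "avoiding n (t - 1) F"
    and D: "is_subcube m n (R, \<alpha>)" "card R \<le> k" "uncapturable n k r F (R, \<alpha>)"
    and D': "is_subcube m n (R', \<beta>)" "card R' \<le> k" "uncapturable n k r F (R', \<beta>)"
    and K: "1 < K" "K ^ q = real m" and r: "r = k + q * k" "2 * real r * K \<le> real m"
    and large_n: "(19/20) ^ l * 4 ^ t < 1 / (2 * real m ^ k)" "2 * l + t + 2 * r \<le> n"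
    and large_m: "2 \<le> m" "9 ^ j * (2 * 4 ^ t * K ^ (t + 1))\<^sup>2 * (2 * 4 ^ t * real m ^ k) powr ((2/3) ^ j) < real m - 1"
  shows "t \<le> card {i \<in> R \<inter> R'. \<alpha> i = \<beta> i}"
proof (rule ccontr)
  let ?A = "{i \<in> R \<inter> R'. \<alpha> i = \<beta> i}"
  let ?N = "{..<n}"
  let ?h = "ind n F"
  define d where "d = t - 1 - card ?A"
  assume "\<not> t \<le> card ?A"
  then have d: "card ?A + d = t - 1" "d \<le> t" by (auto simp: d_def)
  have R: "R \<subseteq> ?N" and R': "R' \<subseteq> ?N" using subcube_subset D D' by auto
  have mk: "0 < 1 / real m ^ k" using m_pos by simp
  \<comment> \<open>Each fixed coordinate contributes a factor \<open>K\<close> to a density that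
    starts at \<open>m^(-k)\<close> and cannot exceed 1, while \<open>K ^ q = m\<close>.\<close>
  have size: "card S \<le> q * k" if "K ^ card S * (1 / real m ^ k) \<le> Av W g z" "finite W" "\<And>z. g z \<le> 1"
    for S :: "nat set" and W g z
  proof -
    have "K ^ card S * (1 / real m ^ k) \<le> 1"
      using that noise_le_const[of W 0 g 1 z] by auto
    then have "K ^ card S \<le> real m ^ k" using m_pos by (simp add: field_simps)
    then have "K ^ card S \<le> K ^ (q * k)" by (simp add: power_mult flip: K(2))
    then show ?thesis using K(1) by simp
  qed
  have K0: "0 \<le> K" using K by simp
  have r_ge: "k \<le> r" by (simp add: r)

  \<comment> \<open>The second family has \<open>R'\<close> fixed to \<open>\<beta>\<close>, and the
    restriction of the first one may run into \<open>R'\<close>. Avoiding \<open>\<beta>\<close>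
    beforehand makes this harmless.\<close>
  define h1 where "h1 = (\<lambda>z. ?h z * off (R' - R) \<beta> z)"
  have h1: "0 \<le> h1 z" "h1 z \<le> 1" "dep ?N h1" for z
    using R' dep_ind[of n F]
    by (auto simp: h1_def ind_range off_range mult_le_one intro!: dep_mult_off)
  have "card (R' - R) \<le> r"
    using D'(2) r_ge card_mono[of R' "R' - R"] finite_subset[OF R'] by auto
  then have "1 / real m ^ k \<le> Av (?N - R) h1 \<alpha>"
    unfolding h1_def using D F R' subcube_less[OF D'(1)] by (intro uncapturable_Av) auto
  note restr = global_restriction[OF finite_Diff[OF finite_lessThan] less_imp_le[OF K(1)] mk this]
  obtain S \<alpha>1 where S: "S \<subseteq> ?N - R" "\<forall>i. i \<notin> S \<longrightarrow> \<alpha>1 i = \<alpha> i"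
      "K ^ card S * (1 / real m ^ k) \<le> Av (?N - R - S) h1 \<alpha>1"
      "\<forall>U y. U \<subseteq> ?N - R - S \<longrightarrow> (\<forall>i. i \<notin> U \<longrightarrow> y i = \<alpha>1 i) \<longrightarrow>
         Av (?N - R - S - U) h1 y \<le> K ^ card U * Av (?N - R - S) h1 \<alpha>1"
    using restr by (elim exE conjE) (rule that)
  define R1 where "R1 = R \<union> S"
  define p where "p = Av (?N - R1) h1 \<alpha>1"
  have NR1: "?N - R - S = ?N - R1" by (auto simp: R1_def)
  note glob1 = S(4)[unfolded NR1, folded p_def]
  have R1: "R1 \<subseteq> ?N" using R S(1) by (auto simp: R1_def)
  have "card S \<le> q * k" by (rule size[OF S(3)]) (use h1 in auto)
  then have cR1: "card R1 \<le> r"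
    using card_Un_le[of R S] D(2) r by (simp add: R1_def)
  have "1 * (1 / real m ^ k) \<le> K ^ card S * (1 / real m ^ k)"
    using K(1) mk by (intro mult_right_mono one_le_power) auto
  then have p: "1 / real m ^ k \<le> p" using S(3) by (simp add: p_def NR1)
  then have p0: "0 < p" using mk by linarith
  \<comment> \<open>Uncapturability concerns only values below \<open>m\<close>, and
    \<open>\<alpha>1\<close> will serve as such values. The positive density \<open>p\<close>
    provides a point of \<open>F\<close> that agrees with \<open>\<alpha>1\<close> on
    \<open>R1\<close>.\<close>
  have \<alpha>1: "\<alpha>1 i < m" if "i \<in> R1" for i
  proof -
    obtain z where z: "\<forall>i. i \<notin> ?N - R1 \<longrightarrow> z i = \<alpha>1 i" "0 < h1 z"
      using Av_pos_witness[of "?N - R1" h1 \<alpha>1] p0 by (auto simp: p_def)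
    have "restrict z ?N \<in> cube m n"
      using z(2) F(1) unfolding h1_def ind_off_pos_iff by blast
    then have "z i < m" using that R1 by (auto simp: cube_def PiE_def Pi_def)
    moreover have "z i = \<alpha>1 i" using z(1) that by auto
    ultimately show ?thesis by simp
  qed

  \<comment> \<open>By now the first restriction is known and bounded by \<open>r\<close>
    coordinates, so uncapturability lets the second family avoid all its values outside
    \<open>R'\<close>.\<close>
  define h2 where "h2 = (\<lambda>z. ?h z * off (R1 - R') \<alpha>1 z)"
  have h2: "0 \<le> h2 z" "h2 z \<le> 1" "dep ?N h2" for z
    using R1 dep_ind[of n F]
    by (auto simp: h2_def ind_range off_range mult_le_one intro!: dep_mult_off)
  have "card (R1 - R') \<le> r"
    using cR1 card_mono[of R1 "R1 - R'"] finite_subset[OF R1] by auto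
  then have "1 / real m ^ k \<le> Av (?N - R') h2 \<beta>"
    unfolding h2_def using D' F R1 \<alpha>1 by (intro uncapturable_Av) auto
  note restr = global_restriction[OF finite_Diff[OF finite_lessThan] less_imp_le[OF K(1)] mk this]
  obtain S' \<alpha>2 where S': "S' \<subseteq> ?N - R'" "\<forall>i. i \<notin> S' \<longrightarrow> \<alpha>2 i = \<beta> i"
      "K ^ card S' * (1 / real m ^ k) \<le> Av (?N - R' - S') h2 \<alpha>2"
      "\<forall>U y. U \<subseteq> ?N - R' - S' \<longrightarrow> (\<forall>i. i \<notin> U \<longrightarrow> y i = \<alpha>2 i) \<longrightarrow>
         Av (?N - R' - S' - U) h2 y \<le> K ^ card U * Av (?N - R' - S') h2 \<alpha>2"
    using restr by (elim exE conjE) (rule that)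
  define R2 where "R2 = R' \<union> S'"
  define p' where "p' = Av (?N - R2) h2 \<alpha>2"
  have NR2: "?N - R' - S' = ?N - R2" by (auto simp: R2_def)
  note glob2 = S'(4)[unfolded NR2, folded p'_def]
  have R2: "R2 \<subseteq> ?N" using R' S'(1) by (auto simp: R2_def)
  have "card S' \<le> q * k" by (rule size[OF S'(3)]) (use h2 in auto)
  then have cR2: "card R2 \<le> r"
    using card_Un_le[of R' S'] D'(2) r by (simp add: R2_def)
  have "1 * (1 / real m ^ k) \<le> K ^ card S' * (1 / real m ^ k)"
    using K(1) mk by (intro mult_right_mono one_le_power) auto
  then have p': "1 / real m ^ k \<le> p'" using S'(3) by (simp add: p'_def NR2)
  then have p'0: "0 < p'" using mk by linarith

  define M where "M = ?N - (R1 \<union> R2)"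
  \<comment> \<open>The coordinates in \<open>S'\<close> were fixed after the first family had been
    made global; that it can avoid their values rests on globalness instead of
    uncapturability.\<close>
  define f where "f = (\<lambda>x. Av (R2 - R1) (\<lambda>z. h1 z * off (R2 - R1) \<alpha>2 z) (override_on x \<alpha>1 R1))"
  define g where "g = (\<lambda>x. Av (R1 - R2) (\<lambda>z. h2 z * off (R1 - R2) \<alpha>1 z) (override_on x \<alpha>2 R2))"
  have "card (R2 - R1) \<le> r" using cR2 card_mono[of R2 "R2 - R1"] finite_subset[OF R2] by auto
  note f = global_average[OF finite_lessThan h1 R1 R2 p_def p0 glob1 this r(2) K0 f_def M_def]
  have "card (R1 - R2) \<le> r" using cR1 card_mono[of R1 "R1 - R2"] finite_subset[OF R1] by auto
  note g = global_average[OF finite_lessThan h2 R2 R1 p'_def p'0 glob2 this r(2) K0 g_def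
      M_def[unfolded Un_commute[of R1 R2]]]
  have finM: "finite M" by (simp add: M_def)
  have "card (R1 \<union> R2) \<le> 2 * r" using card_Un_le[of R1 R2] cR1 cR2 by linarith
  moreover have "card M = n - card (R1 \<union> R2)"
    unfolding M_def using R1 R2 finite_subset[of _ ?N] by (subst card_Diff_subset) auto
  ultimately have cM: "2 * l + d \<le> card M" using large_n(2) d(2) by linarith
  \<comment> \<open>The 2 in \<open>large_n\<close> pays for the half of the density lost in passing
    to \<open>f\<close> and \<open>g\<close>.\<close>
  have small: "(19/20) ^ l * 4 ^ d < P / 2" if "1 / real m ^ k \<le> P" for P :: real
  proof -
    have "(19/20) ^ l * 4 ^ d \<le> (19/20 :: real) ^ l * 4 ^ t"
      using d(2) by (intro mult_left_mono power_increasing) auto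
    also have "\<dots> < (1 / real m ^ k) / 2" using large_n(1) by simp
    also have "\<dots> \<le> P / 2" using that by simp
    finally show ?thesis .
  qed
  have "(19/20) ^ l * 4 ^ d < Av M f \<alpha>" "(19/20) ^ l * 4 ^ d < Av M g \<alpha>"
    using f(4)[of \<alpha>] g(4)[of \<alpha>] small[OF p] small[OF p'] by linarith+
  note dense = common_dense_values[OF finM cM f(1,2) this(1) g(1,2) this(2)]
  obtain T z where T: "T \<subseteq> M" "card T = d"
    "Av M f \<alpha> / 4 ^ d \<le> Av (M - T) f z" "Av M g \<alpha> / 4 ^ d \<le> Av (M - T) g z"
    using dense by (elim exE conjE) (rule that)
  define \<mu> where "\<mu> = Av (M - T) f z"
  define \<nu> where "\<nu> = Av (M - T) g z"
  have dens: "P \<le> 2 * 4 ^ t * Q" if "P / 2 \<le> W" "W / 4 ^ d \<le> Q" "0 < P" for P Q W :: real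
  proof -
    have "P / 2 / 4 ^ d \<le> W / 4 ^ d" using that by (intro divide_right_mono) auto
    then have "P / 2 / 4 ^ d \<le> Q" using that by linarith
    then have le: "P \<le> 2 * 4 ^ d * Q" by (simp add: field_simps)
    then have "0 < 2 * 4 ^ d * Q" using that(3) by linarith
    then have "0 \<le> Q" by (simp add: zero_less_mult_iff)
    then have "2 * 4 ^ d * Q \<le> 2 * 4 ^ t * Q"
      using d(2) by (intro mult_right_mono mult_left_mono power_increasing) auto
    with le show ?thesis by linarith
  qed
  have \<mu>: "p \<le> 2 * 4 ^ t * \<mu>" unfolding \<mu>_def by (rule dens[OF f(4) T(3) p0])
  have \<nu>: "p' \<le> 2 * 4 ^ t * \<nu>" unfolding \<nu>_def by (rule dens[OF g(4) T(4) p'0])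
  have pos: "0 < Q" "1 / Q \<le> 2 * 4 ^ t * real m ^ k" if "1 / real m ^ k \<le> P" "P \<le> 2 * 4 ^ t * Q" for P Q :: real
  proof -
    have le: "1 / real m ^ k \<le> 2 * 4 ^ t * Q" using that by linarith
    then have "0 < 2 * 4 ^ t * Q" using mk by linarith
    then show "0 < Q" by (simp add: zero_less_mult_iff)
    with le m_pos show "1 / Q \<le> 2 * 4 ^ t * real m ^ k" by (simp add: field_simps)
  qed
  let ?K = "2 * 4 ^ t * K ^ (t + 1)"
  have "1 * 1 * 1 \<le> ?K" using K by (intro mult_mono one_le_power) auto
  then have K1: "1 \<le> ?K" by simp
  let ?f = "\<lambda>x. f (override_on x z T)" and ?g = "\<lambda>x. g (override_on x z T)"
  have "\<exists>x y. (\<forall>i\<in>M - T. x i < m \<and> y i < m \<and> x i \<noteq> y i) \<and> (\<forall>i. i \<notin> M - T \<longrightarrow> x i = z i \<and> y i = z i)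
    \<and> 0 < ?f x \<and> 0 < ?g y"
  proof (rule disagreeing_pair[OF _ large_m(1) K1 pos(1)[OF p \<mu>] pos(1)[OF p' \<nu>] pos(2)[OF p \<mu>] pos(2)[OF p' \<nu>]])
    fix U x assume U: "U \<subseteq> M - T"
    show "Av (M - T - U) ?f x \<le> ?K ^ card U * \<mu>"
      by (rule global_fix[OF finM T(1) _ f(3) _ p0 f(5) \<mu>_def \<mu> U]) (use d T K K0 in auto)
    show "Av (M - T - U) ?g x \<le> ?K ^ card U * \<nu>"
      by (rule global_fix[OF finM T(1) _ g(3) _ p'0 g(5) \<nu>_def \<nu> U]) (use d T K K0 in auto)
  next
    have zz: "override_on z z T = z" by (simp add: override_on_def)
    have "Av (M - T) ?f z = Av (M - T) f (override_on z z T)" "Av (M - T) ?g z = Av (M - T) g (override_on z z T)"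
      using finM by (intro Av_override; auto)+
    then show "\<mu> \<le> Av (M - T) ?f z" "\<nu> \<le> Av (M - T) ?g z"
      by (simp_all add: \<mu>_def \<nu>_def zz)
  qed (use finM f(1,2) g(1,2) K0 large_m in auto)
  then obtain x y where xy: "\<forall>i\<in>M - T. x i \<noteq> y i" "0 < ?f x" "0 < ?g y" by blast
  obtain u where u: "0 < h1 u" "\<forall>i\<in>R1. u i = \<alpha>1 i" "\<forall>i\<in>M. u i = override_on x z T i" "\<forall>i\<in>R2 - R1. u i \<noteq> \<alpha>2 i"
    using f(6)[OF xy(2)] by blast
  obtain w where w: "0 < h2 w" "\<forall>i\<in>R2. w i = \<alpha>2 i" "\<forall>i\<in>M. w i = override_on y z T i" "\<forall>i\<in>R1 - R2. w i \<noteq> \<alpha>1 i"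
    using g(6)[OF xy(3)] by blast
  have uF: "restrict u ?N \<in> F" and u\<beta>: "\<forall>i\<in>R' - R. u i \<noteq> \<beta> i"
    using u(1) unfolding h1_def ind_off_pos_iff by blast+
  have wF: "restrict w ?N \<in> F" and w\<alpha>: "\<forall>i\<in>R1 - R'. w i \<noteq> \<alpha>1 i"
    using w(1) unfolding h2_def ind_off_pos_iff by blast+
  \<comment> \<open>Outside \<open>R \<inter> R'\<close> one of the two points avoids the other's
    fixed value: \<open>w\<close> on \<open>R1 - R'\<close>, \<open>u\<close> on
    \<open>S \<inter> R'\<close> and on \<open>R2 - R1\<close>. On \<open>M\<close> the pair
    coincides exactly on \<open>T\<close>.\<close>
  have agree: "u i = w i \<longleftrightarrow> i \<in> ?A \<union> T" if i: "i \<in> ?N" for i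
  proof -
    consider "i \<in> R" "i \<in> R'" | "i \<in> R1" "i \<notin> R'" | "i \<in> S" "i \<in> R'" | "i \<notin> R1" "i \<in> R2" | "i \<in> M"
      using i unfolding M_def R1_def by blast
    then show ?thesis
    proof cases
      case 1
      then have "u i = \<alpha> i" "w i = \<beta> i" "i \<notin> T"
        using u(2) w(2) S(1,2) S'(1,2) T(1) by (auto simp: R1_def R2_def M_def)
      with 1 show ?thesis by auto
    next
      case 2
      then have "w i \<noteq> \<alpha>1 i" "u i = \<alpha>1 i" "i \<notin> T" using u(2) w\<alpha> T(1) by (auto simp: M_def)
      with 2 show ?thesis by auto
    next
      case 3
      then have "i \<notin> R" "i \<notin> S'" using S(1) S'(1) by auto
      then have "u i \<noteq> \<beta> i" "w i = \<beta> i" using 3 u\<beta> w(2) S'(2) by (auto simp: R2_def)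
      moreover have "i \<notin> T" using 3 T(1) by (auto simp: M_def R1_def)
      ultimately show ?thesis using \<open>i \<notin> R\<close> by auto
    next
      case 4
      then have "u i \<noteq> \<alpha>2 i" "w i = \<alpha>2 i" using u(4) w(2) by auto
      moreover have "i \<notin> T" "i \<notin> R" using 4 T(1) by (auto simp: M_def R1_def)
      ultimately show ?thesis by auto
    next
      case 5
      then have "i \<notin> ?A" by (auto simp: M_def R1_def)
      then show ?thesis using u(3) w(3) xy(1) 5 by (auto simp: override_on_def)
    qed
  qed
  have "{i \<in> ?N. restrict u ?N i = restrict w ?N i} = ?A \<union> T"
    using agree R T(1) by (auto simp: M_def)
  moreover have "card (?A \<union> T) = t - 1"
    using T finite_subset[OF R] finite_subset[OF T(1) finM] d(1)
    by (subst card_Un_disjoint) (auto simp: M_def R1_def)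
  ultimately have "agr n (restrict u ?N) (restrict w ?N) = t - 1" by (simp add: agr_def)
  then show False using F(2) uF wF by (auto simp: avoiding_def)
qed

end

section \<open>Choice of the constants\<close>

lemma cover_by_intersecting_subcubes:
  fixes t k :: nat
  assumes t: "1 \<le> t"
  shows "\<exists>C m0 N :: nat. \<forall>m n :: nat. \<forall>F.
     F \<subseteq> cube m n \<longrightarrow> avoiding n (t - 1) F \<longrightarrow> m \<ge> m0 \<longrightarrow>
     real n \<ge> real N * ln (real m) \<longrightarrow>
     (\<exists>\<D>. finite \<D> \<and> card \<D> \<le> C \<and>
        (\<forall>D\<in>\<D>. is_subcube m n D \<and> card (fst D) \<le> k) \<and>
        t_intersecting_cubes t \<D> \<and>
        mu m n (F - union_cubes m n \<D>) \<le> real C * real m powr (- real k))"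
proof -
  \<comment> \<open>With \<open>K = m^(1/q)\<close>, the growth rate after fixing up to
    \<open>t\<close> coordinates is \<open>K ^ (t + 1)\<close> up to constants, and its square is
    \<open>m^(1/4)\<close>.\<close>
  define q where "q = 8 * (t + 1)"
  \<comment> \<open>At most \<open>k\<close> coordinates of a subcube and \<open>q * k\<close> more
    fixed for globalness.\<close>
  define r where "r = k + q * k"
  \<comment> \<open>Enough smoothing steps to bring the inverse density \<open>m^k\<close> down to
    \<open>m^(1/4)\<close>.\<close>
  obtain j where j: "(2/3 :: real) ^ j < 1 / (4 * (real k + 1))"
    using real_arch_pow_inv[of "1 / (4 * (real k + 1))" "2/3"] by auto
  \<comment> \<open>\<open>9 ^ j\<close> comes from the smoothing; \<open>8 * 64 ^ t\<close> is the
    cube of \<open>2 * 4 ^ t\<close>, twice from the squared growth rate and once from the bound on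
    the inverse density.\<close>
  define A :: nat where "A = 9 ^ j * (8 * 64 ^ t)"
  \<comment> \<open>The square makes \<open>sqrt m\<close> at least \<open>A + 2 + 2 * r\<close>,
    which gives both \<open>A * sqrt m < m - 1\<close> and \<open>2 * r * K \<le> m\<close>. The
    summand \<open>2 * 4 ^ t\<close> is for the bound on \<open>(19/20) ^ l\<close>, and 3 ensures
    \<open>ln m \<ge> 1\<close>.\<close>
  define m0 where "m0 = (A + 2 + 2 * r)\<^sup>2 + 2 * 4 ^ t + 3"
  \<comment> \<open>\<open>40 * (k + 1)\<close> accounts for \<open>2 * l\<close>, the 2 for
    rounding \<open>l\<close> up; the remaining terms are absorbed since
    \<open>ln m \<ge> 1\<close>.\<close>
  define N where "N = 40 * (k + 1) + 2 + t + 2 * r"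
  show ?thesis
  proof (rule exI[of _ "(r + 1) ^ k"], rule exI[of _ m0], rule exI[of _ N], intro allI impI)
    fix m n :: nat and F :: "(nat \<Rightarrow> nat) set"
    assume F: "F \<subseteq> cube m n" "avoiding n (t - 1) F" and m: "m0 \<le> m" and n: "real N * ln (real m) \<le> real n"
    have m3: "3 \<le> m" and m4: "2 * 4 ^ t < m" and msq: "(A + 2 + 2 * r)\<^sup>2 \<le> m"
      using m by (auto simp: m0_def)
    interpret alphabet m by standard (use m3 in simp)
    have m0': "0 < real m" and m1: "1 < real m" using m3 by auto
    define K where "K = real m powr (1 / real q)"
    have q8: "8 \<le> q" by (simp add: q_def)
    have Kq: "K ^ q = real m"
      using m0' q8 by (simp add: K_def powr_power)
    have K1: "1 < K" unfolding K_def using m1 q8 by (intro gr_one_powr) auto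
    have sq: "real (A + 2 + 2 * r) \<le> sqrt (real m)"
      using of_nat_mono[OF msq, where 'a = real] by (intro real_le_rsqrt) (simp only: of_nat_power)
    have sqm: "sqrt (real m) * sqrt (real m) = real m" by simp
    have K_sqrt: "K \<le> sqrt (real m)"
      unfolding K_def powr_half_sqrt[symmetric, OF less_imp_le[OF m0']] using m1 q8
      by (intro powr_mono) (auto simp: field_simps)
    have h2: "2 * real r * K \<le> real m"
    proof -
      have "2 * real r * K \<le> sqrt (real m) * sqrt (real m)"
        using sq K_sqrt K1 by (intro mult_mono) auto
      then show ?thesis by simp
    qed
    have h3: "9 ^ j * (2 * 4 ^ t * K ^ (t + 1))\<^sup>2 * (2 * 4 ^ t * real m ^ k) powr ((2/3) ^ j) < real m - 1"
    proof -
      have e1: "(2/3 :: real) ^ j \<le> 1" by (rule power_le_one) auto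
      have "(1 :: real) \<le> 4 ^ t" by (rule one_le_power) simp
      then have c1: "1 \<le> (2 * 4 ^ t :: real)" by linarith
      have "(2 * 4 ^ t * real m ^ k) powr ((2/3) ^ j)
          = (2 * 4 ^ t) powr ((2/3) ^ j) * real m powr (real k * (2/3) ^ j)"
        using m0' by (simp add: powr_mult powr_powr flip: powr_realpow)
      also have "\<dots> \<le> (2 * 4 ^ t) powr 1 * real m powr (1/4)"
      proof (intro mult_mono powr_mono)
        have "real k * (2/3) ^ j \<le> (real k + 1) * (1 / (4 * (real k + 1)))"
          using j by (intro mult_mono) auto
        also have "\<dots> = 1/4" by (simp add: field_simps)
        finally show "real k * (2/3) ^ j \<le> 1/4" .
      qed (use e1 c1 m1 in auto)
      finally have B: "(2 * 4 ^ t * real m ^ k) powr ((2/3) ^ j) \<le> 2 * 4 ^ t * real m powr (1/4)"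
        by simp
      have e16: "(4 ^ t)\<^sup>2 = (16 :: real) ^ t"
        by (simp add: power2_eq_square flip: power_mult_distrib)
      have e4: "1 / real q * real (2 * (t + 1)) = 1/4"
        unfolding q_def by (simp add: field_simps)
      have "(K ^ (t + 1))\<^sup>2 = K ^ (2 * (t + 1))" by (metis mult.commute power_mult)
      also have "\<dots> = K powr real (2 * (t + 1))" using K1 by (intro powr_realpow[symmetric]) simp
      also have "\<dots> = real m powr (1/4)" unfolding K_def powr_powr e4 ..
      finally have "(2 * 4 ^ t * K ^ (t + 1))\<^sup>2 = 4 * 16 ^ t * real m powr (1/4)"
        using e16 by (simp only: power_mult_distrib) simp
      then have "9 ^ j * (2 * 4 ^ t * K ^ (t + 1))\<^sup>2 * (2 * 4 ^ t * real m ^ k) powr ((2/3) ^ j)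
          \<le> 9 ^ j * (4 * 16 ^ t * real m powr (1/4)) * (2 * 4 ^ t * real m powr (1/4))"
        using B by (intro mult_mono) auto
      also have "\<dots> = 9 ^ j * (8 * (16 ^ t * 4 ^ t)) * (real m powr (1/4) * real m powr (1/4))"
        by simp
      also have "real m powr (1/4) * real m powr (1/4) = sqrt (real m)"
        using m0' by (simp add: powr_half_sqrt flip: powr_add)
      also have "(16 ^ t * 4 ^ t :: real) = 64 ^ t" by (simp flip: power_mult_distrib)
      also have "9 ^ j * (8 * 64 ^ t) * sqrt (real m) = real A * sqrt (real m)"
        by (simp add: A_def)
      also have "\<dots> < real m - 1"
      proof -
        have "real (A + 2) * sqrt (real m) \<le> sqrt (real m) * sqrt (real m)"
          using sq by (intro mult_right_mono) auto
        then have "real A * sqrt (real m) + 2 * sqrt (real m) \<le> real m" by (simp add: distrib_right)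
        moreover have "1 \<le> sqrt (real m)" using m1 by (intro real_le_rsqrt) simp
        ultimately show ?thesis by linarith
      qed
      finally show ?thesis .
    qed
    \<comment> \<open>As \<open>19/20 \<le> e^(-1/20)\<close>, this gives
      \<open>(19/20) ^ l \<le> m^(-(k + 1))\<close>; the spare factor \<open>m\<close> beats
      \<open>2 * 4 ^ t\<close>.\<close>
    define l where "l = nat \<lceil>20 * (real k + 1) * ln (real m)\<rceil>"
    have ln1: "1 \<le> ln (real m)"
    proof -
      have "exp 1 \<le> real m" using exp_le m3 by linarith
      then show ?thesis using m0' by (simp add: ln_ge_iff)
    qed
    have l1: "20 * (real k + 1) * ln (real m) \<le> real l" unfolding l_def by (rule real_nat_ceiling_ge)
    have "0 \<le> 20 * (real k + 1) * ln (real m)" using ln1 by (intro mult_nonneg_nonneg) auto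
    then have l2: "real l \<le> 20 * (real k + 1) * ln (real m) + 1" unfolding l_def by linarith
    have h4: "(19/20) ^ l * 4 ^ t < 1 / (2 * real m ^ k)"
    proof -
      have "(19/20 :: real) ^ l \<le> exp (- 1/20) ^ l"
        using exp_ge_add_one_self[of "- 1/20"] by (intro power_mono) auto
      also have "\<dots> = exp (- (real l / 20))" by (simp flip: exp_of_nat_mult)
      also have "\<dots> \<le> exp (- (ln (real m) * real (k + 1)))" using l1 by (simp add: algebra_simps)
      also have "\<dots> = 1 / real m ^ (k + 1)"
        using m0' by (simp add: exp_minus exp_of_nat2_mult inverse_eq_divide del: of_nat_add power_Suc of_nat_Suc)
      finally have "(19/20) ^ l * 4 ^ t \<le> 1 / real m ^ (k + 1) * 4 ^ t"
        by (intro mult_right_mono) auto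
      also have "\<dots> < 1 / real m ^ (k + 1) * (real m / 2)"
      proof (intro mult_strict_left_mono)
        have "real (2 * 4 ^ t) < real m" using m4 by (simp only: of_nat_less_iff)
        then show "4 ^ t < real m / 2" by simp
      qed (use m0' in simp)
      also have "\<dots> = 1 / (2 * real m ^ k)" using m0' by simp
      finally show ?thesis .
    qed
    have h5: "2 * l + t + 2 * r \<le> n"
    proof -
      have "real (2 * l + t + 2 * r) \<le> 40 * (real k + 1) * ln (real m) + real (2 + t + 2 * r) * 1"
        using l2 by (simp add: algebra_simps)
      also have "\<dots> \<le> 40 * (real k + 1) * ln (real m) + real (2 + t + 2 * r) * ln (real m)"
        using ln1 by (intro add_left_mono mult_left_mono) auto
      also have "\<dots> = real N * ln (real m)" by (simp add: N_def algebra_simps)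
      also have "\<dots> \<le> real n" by (rule n)
      finally show ?thesis by (simp only: of_nat_le_iff)
    qed
    have "is_subcube m n ({}, \<lambda>_. undefined)" by (simp add: is_subcube_def)
    from uncapturable_cover[OF F(1) this, of k k r] obtain \<D> where \<D>: "finite \<D>" "card \<D> \<le> (r + 1) ^ k"
      "\<forall>D\<in>\<D>. is_subcube m n D \<and> card (fst D) \<le> k \<and> uncapturable n k r F D"
      "mu m n (F \<inter> subcube m n {} (\<lambda>_. undefined) - union_cubes m n \<D>) \<le> real ((r + 1) ^ k) / real m ^ k"
      by auto
    have "t_intersecting_cubes t \<D>"
      unfolding t_intersecting_cubes_def
    proof clarify
      fix R \<alpha> R' \<beta> assume D: "(R, \<alpha>) \<in> \<D>" "(R', \<beta>) \<in> \<D>"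
      show "t \<le> card {i \<in> R \<inter> R'. \<alpha> i = \<beta> i}"
        using \<D>(3)[rule_format, OF D(1)] \<D>(3)[rule_format, OF D(2)] m3
        by (intro uncapturable_agree[OF F _ _ _ _ _ _ K1 Kq r_def h2 h4 h5 _ h3]) auto
    qed
    moreover have "F \<inter> subcube m n {} (\<lambda>_. undefined) = F" using F(1) by (auto simp: subcube_def)
    moreover have "real m powr (- real k) = 1 / real m ^ k"
      using m0' by (simp add: powr_minus powr_realpow inverse_eq_divide)
    ultimately show "\<exists>\<D>. finite \<D> \<and> card \<D> \<le> (r + 1) ^ k \<and>
        (\<forall>D\<in>\<D>. is_subcube m n D \<and> card (fst D) \<le> k) \<and>
        t_intersecting_cubes t \<D> \<and>
        mu m n (F - union_cubes m n \<D>) \<le> real ((r + 1) ^ k) * real m powr (- real k)"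
      using \<D> by (intro exI[of _ \<D>]) auto
  qed
qed

theorem theorem6p3:
  fixes t k :: nat
  shows "\<exists>C m0 N :: nat. \<forall>m n :: nat. \<forall>F.
     F \<subseteq> cube m n \<longrightarrow> avoiding n (t - 1) F \<longrightarrow> m \<ge> m0 \<longrightarrow>
     real n \<ge> real N * ln (real m) \<longrightarrow>
     (\<exists>\<D>. finite \<D> \<and> card \<D> \<le> C \<and>
        (\<forall>D\<in>\<D>. is_subcube m n D \<and> card (fst D) \<le> k) \<and>
        t_intersecting_cubes t \<D> \<and>
        mu m n (F - union_cubes m n \<D>) \<le> real C * real m powr (- real k))"
proof (cases "t = 0")
  \<comment> \<open>Any collection is 0-intersecting, so the whole cube, as the subcube with nothing
    fixed, covers \<open>F\<close> by itself.\<close>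
  case True
  have "mu m n (F - union_cubes m n {({}, \<lambda>_. undefined)}) = 0" if "F \<subseteq> cube m n" for F m n
  proof -
    have empty: "F - union_cubes m n {({}, \<lambda>_. undefined)} = {}"
      using that by (auto simp: union_cubes_def subcube_def)
    show ?thesis unfolding empty by (simp add: mu_def)
  qed
  then show ?thesis
    using True
    by (intro exI[of _ "1 :: nat"] allI impI exI[of _ "{({}, \<lambda>_. undefined)}"])
      (auto simp: is_subcube_def t_intersecting_cubes_def)
next
  case False
  then show ?thesis by (intro cover_by_intersecting_subcubes) simp
qed

end
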